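(* Let $0<s<1$ and $1<p<\infty$ satisfy $sp=1$. There is a bounded domain $G\subset\mathbb{R}^2$ which admits an $(s,p)$-zero extension and for which $\mathrm{cap}_{s,p}(\cdot,G)$ is not weakly $\mathcal{W}(G)$-quasiadditive.
   Context: All definitions are applied with $n=2$. A domain is a nonempty connected open set. $C_c(G)$ denotes the space of (real-valued) continuous functions with compact support in $G$. For an open set $G\subset\mathbb{R}^n$ and a measurable function $u$ on $G$, put $$|u|_{W^{s,p}(G)}=\left(\int_G\int_G\frac{|u(x)-u(y)|^p}{|x-y|^{n+sp}}\,dy\,dx\right)^{1/p}\in[0,\infty].$$ Capacity: for a compact set $K\subset G$, $\mathrm{cap}_{s,p}(K,G)=\inf_u |u|_{W^{s,p}(G)}^p$, where the infimum ranges over all real-valued $u\in C_c(G)$ such that $u(x)\ge 1$ for every $x\in K$. Whitney cubes: for an open set $\emptyset\neq G\subsetneq\mathbb{R}^n$, $\mathcal{W}(G)$ is a fixed (standard) Whitney decomposition of $G$: a family of closed dyadic cubes with pairwise disjoint interiors such that $G=\bigcup_{Q\in\mathcal{W}(G)}Q$, $\mathrm{diam}(Q)\le\mathrm{dist}(Q,\partial G)\le 4\,\mathrm{diam}(Q)$ for each $Q\in\mathcal{W}(G)$, and $\sum_{Q\in\mathcal{W}(G)}\chi_{Q^{**}}\le C_n\chi_G$, where $Q^{**}=\tfrac98 Q$ is the concentric dilation of $Q$ and $C_n$ depends only on $n$. Weak quasiadditivity: $\mathrm{cap}_{s,p}(\cdot,G)$ is weakly $\mathcal{W}(G)$-quasiadditive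 if there is a constant $N>0$ such that $$\sum_{Q\in\mathcal{W}(G)}\mathrm{cap}_{s,p}(K\cap Q,G)\le N\,\mathrm{cap}_{s,p}(K,G)$$ for every set $K$ of the form $K=\bigcup_{Q\in\mathcal{E}}Q$ with $\mathcal{E}\subset\mathcal{W}(G)$ finite. Zero extension: $G$ admits an $(s,p)$-zero extension if there is a constant $C>0$ such that $|E_Gu|_{W^{s,p}(\mathbb{R}^n)}\le C\,|u|_{W^{s,p}(G)}$ for every $u\in C_c(G)$, where $E_Gu(x)=u(x)$ if $x\in G$ and $E_Gu(x)=0$ otherwise. *)

theory Defs
  imports "HOL-Analysis.Analysis"
begin

text \<open>Powers of extended nonnegative reals with a positive real exponent.\<close>

definition ennpowr :: "ennreal \<Rightarrow> real \<Rightarrow> ennreal" where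
  "ennpowr x a = (if x = \<infinity> then \<infinity> else ennreal (enn2real x powr a))"

text \<open>The value of the integrand on the diagonal is \<open>0\<close> (as \<open>0 / 0 = 0\<close>); the diagonal is
  a null set. Only the values of \<open>u\<close> on \<open>G\<close> matter.\<close>

definition gagliardo_seminorm :: "real \<Rightarrow> real \<Rightarrow> (real^'n) set \<Rightarrow> (real^'n \<Rightarrow> real) \<Rightarrow> ennreal" where
  "gagliardo_seminorm s p G u =
     ennpowr (set_nn_integral lborel G (\<lambda>x. set_nn_integral lborel G (\<lambda>y.
        ennreal (\<bar>u x - u y\<bar> powr p / dist x y powr (real CARD('n) + s * p))))) (1 / p)"

text \<open>A function on \<open>G\<close> is represented by a total function whose values outside \<open>G\<close> are
  irrelevant. The support is the closure relative to \<open>G\<close> of the set where the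
  function does not vanish.\<close>

definition Cc :: "(real^'n) set \<Rightarrow> (real^'n \<Rightarrow> real) set" where
  "Cc G = {u. continuous_on G u \<and> compact (G \<inter> closure (support_on G u))}"

definition frac_cap :: "real \<Rightarrow> real \<Rightarrow> (real^'n) set \<Rightarrow> (real^'n) set \<Rightarrow> ennreal" where
  "frac_cap s p K G =
     (INF u\<in>{u \<in> Cc G. \<forall>x\<in>K. u x \<ge> 1}. ennpowr (gagliardo_seminorm s p G u) p)"

definition dyadic_cube :: "(real^'n) set \<Rightarrow> bool" where
  "dyadic_cube Q \<longleftrightarrow> (\<exists>(k::int) (m::int^'n).
     Q = cbox (\<chi> i. of_int (m $ i) * 2 powi k) (\<chi> i. (of_int (m $ i) + 1) * 2 powi k))"

definition dilate_cube :: "real \<Rightarrow> (real^'n) set \<Rightarrow> (real^'n) set" where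
  "dilate_cube t Q =
     (let c = midpoint (interval_lowerbound Q) (interval_upperbound Q)
      in (\<lambda>x. c + t *\<^sub>R (x - c)) ` Q)"

definition whitney_decomposition :: "real \<Rightarrow> (real^'n) set \<Rightarrow> (real^'n) set set \<Rightarrow> bool" where
  "whitney_decomposition C G \<W> \<longleftrightarrow>
     (\<forall>Q\<in>\<W>. dyadic_cube Q) \<and>
     pairwise (\<lambda>Q R. interior Q \<inter> interior R = {}) \<W> \<and>
     G = \<Union>\<W> \<and>
     (\<forall>Q\<in>\<W>. diameter Q \<le> setdist Q (frontier G) \<and> setdist Q (frontier G) \<le> 4 * diameter Q) \<and>
     (\<forall>x. (\<Sum>\<^sub>\<infinity>Q\<in>\<W>. indicator (dilate_cube (9/8) Q) x :: ennreal) \<le> ennreal C * indicator G x)"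

text \<open>A fixed choice of a Whitney decomposition for every nonempty proper open subset, with one
  overlap constant that depends only on the dimension.\<close>

definition whitney_choice :: "((real^'n) set \<Rightarrow> (real^'n) set set) \<Rightarrow> bool" where
  "whitney_choice \<W> \<longleftrightarrow>
     (\<exists>C. \<forall>G. open G \<and> G \<noteq> {} \<and> G \<noteq> UNIV \<longrightarrow> whitney_decomposition C G (\<W> G))"

definition weakly_quasiadditive :: "real \<Rightarrow> real \<Rightarrow> (real^'n) set \<Rightarrow> (real^'n) set set \<Rightarrow> bool" where
  "weakly_quasiadditive s p G \<W> \<longleftrightarrow>
     (\<exists>N>0. \<forall>\<E>. finite \<E> \<and> \<E> \<subseteq> \<W> \<longrightarrow>
        (\<Sum>\<^sub>\<infinity>Q\<in>\<W>. frac_cap s p (\<Union>\<E> \<inter> Q) G) \<le> ennreal N * frac_cap s p (\<Union>\<E>) G)"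

definition zero_extension :: "(real^'n) set \<Rightarrow> (real^'n \<Rightarrow> real) \<Rightarrow> real^'n \<Rightarrow> real" where
  "zero_extension G u = (\<lambda>x. if x \<in> G then u x else 0)"

definition admits_zero_extension :: "real \<Rightarrow> real \<Rightarrow> (real^'n) set \<Rightarrow> bool" where
  "admits_zero_extension s p G \<longleftrightarrow>
     (\<exists>C>0. \<forall>u\<in>Cc G.
        gagliardo_seminorm s p UNIV (zero_extension G u) \<le> ennreal C * gagliardo_seminorm s p G u)"

lemma ennpowr_inverse_exponent: "ennpowr (ennpowr x (1 / p)) p = x" if "p > 0"
  using that by (cases x) (auto simp: ennpowr_def powr_powr)

end

theory Submission
  imports Defs
begin

text \<open>Let \<open>\<Omega>\<close> be the unit disc and remove from every Whitney cube of \<open>\<Omega>\<close> a scaled copy of a fixed null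
  set in the interior of the unit square: the product of a Cantor set with a segment, together with
  one isolated parallel segment. The product has dimension larger than \<open>2 - s p = 1\<close>, hence every
  function that vanishes on it satisfies a Poincare inequality on the square. On each Whitney cube
  this controls \<open>\<integral> \<bar>u\<bar>\<^sup>p / dist(x, \<partial>\<Omega>)\<close>, which is the cost of the zero extension, since the removed
  set is null.

  Whitney cubes of side \<open>\<ell>\<close> have capacity comparable to \<open>\<ell>\<close>, and those of the perforated domain that
  lie near an isolated segment have infinite total side length. A segment has dimension exactly
  \<open>2 - s p\<close>, so the union of any finite number of them has capacity bounded by a
  constant, which rules out weak quasiadditivity.\<close>

section \<open>Fractional energies\<close>

text \<open>The perforation is forced by the critical exponent. On the disc itself, functions in
  \<open>Cc\<close> can tend to the constant 1 with energy tending to 0 when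
  \<open>s * p = 1\<close>, while their zero extensions keep a cost bounded below, so the disc
  admits no zero extension. The holes take over the role of the circle: they enforce vanishing at
  every scale, in proportion to the distance from the circle.

  The counterexample rests on a mismatch. The Whitney cubes of the perforated domain shrink towards
  an isolated segment, because they react to metric distance, whereas the energy hardly notices the
  segment.

  A function in \<open>Cc\<close> of the perforated domain has compact support away from each hole,
  so it vanishes on a thick finite-level approximation of the Cantor part; the Poincare inequality
  is proved for these approximations with a constant that does not depend on the level.\<close>

lemma powr_split:
  fixes p :: real
  assumes "p > 0"
  obtains c where "c > 0"
    "\<And>a b :: real. \<bar>a\<bar> powr p \<le> 3/2 * \<bar>b\<bar> powr p + c * \<bar>a - b\<bar> powr p"
proof
  \<comment> \<open>\<open>\<theta> powr (-p) = 3/2\<close>: either \<open>\<bar>b\<bar>\<close> is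
    at least \<open>\<theta> * \<bar>a\<bar>\<close>, or the difference carries the fraction
    \<open>1 - \<theta>\<close> of \<open>\<bar>a\<bar>\<close>. The leading factor must stay below
    2 for the scale recursions below to contract, which the convexity constant
    \<open>2 powr (p - 1)\<close> violates once \<open>p \<ge> 2\<close>.\<close>
  define \<theta> where "\<theta> = (2/3) powr (1/p)"
  have \<theta>: "0 < \<theta>" "\<theta> < 1" "\<theta> powr p = 2/3"
    using assms powr_less_mono2[of "1/p" "2/3" 1] by (auto simp: \<theta>_def powr_powr)
  show "(1 - \<theta>) powr (-p) > 0" using \<theta> by simp
  fix a b :: real
  show "\<bar>a\<bar> powr p \<le> 3/2 * \<bar>b\<bar> powr p + (1 - \<theta>) powr (-p) * \<bar>a - b\<bar> powr p"
  proof (cases "(1 - \<theta>) * \<bar>a\<bar> \<le> \<bar>a - b\<bar>")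
    case True
    have "(1 - \<theta>) powr p * \<bar>a\<bar> powr p = ((1 - \<theta>) * \<bar>a\<bar>) powr p"
      using \<theta> by (simp add: powr_mult)
    also have "\<dots> \<le> \<bar>a - b\<bar> powr p"
      using True \<theta> assms by (intro powr_mono2) auto
    finally have "\<bar>a\<bar> powr p \<le> (1 - \<theta>) powr (-p) * \<bar>a - b\<bar> powr p"
      using \<theta> by (simp add: powr_minus field_simps)
    moreover have "0 \<le> \<bar>b\<bar> powr p" by simp
    ultimately show ?thesis by linarith
  next
    case False
    then have "\<theta> * \<bar>a\<bar> \<le> \<bar>b\<bar>" by (simp add: algebra_simps)
    then have "(\<theta> * \<bar>a\<bar>) powr p \<le> \<bar>b\<bar> powr p"
      using \<theta> assms by (intro powr_mono2) auto
    then have "2/3 * \<bar>a\<bar> powr p \<le> \<bar>b\<bar> powr p"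
      using \<theta> by (simp add: powr_mult)
    moreover have "0 \<le> (1 - \<theta>) powr (-p) * \<bar>a - b\<bar> powr p" by simp
    ultimately show ?thesis by linarith
  qed
qed

text \<open>The exponent 3 is \<open>n + s * p\<close> with \<open>n = 2\<close> and
  \<open>s * p = 1\<close>, so only \<open>p\<close> remains as a parameter; the energies below are
  \<open>p\<close>-th powers of seminorms.\<close>

definition gag_kernel :: "real \<Rightarrow> (real^2 \<Rightarrow> real) \<Rightarrow> real^2 \<Rightarrow> real^2 \<Rightarrow> ennreal" where
  "gag_kernel p v x y = ennreal (\<bar>v x - v y\<bar> powr p / dist x y powr 3)"

definition cross_energy :: "real \<Rightarrow> (real^2) set \<Rightarrow> (real^2) set \<Rightarrow> (real^2 \<Rightarrow> real) \<Rightarrow> ennreal" where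
  "cross_energy p A B v = (\<integral>\<^sup>+x\<in>A. (\<integral>\<^sup>+y\<in>B. gag_kernel p v x y \<partial>lborel) \<partial>lborel)"

abbreviation energy :: "real \<Rightarrow> (real^2) set \<Rightarrow> (real^2 \<Rightarrow> real) \<Rightarrow> ennreal" where
  "energy p A v \<equiv> cross_energy p A A v"

abbreviation affine_map :: "real^2 \<Rightarrow> real \<Rightarrow> real^2 \<Rightarrow> real^2" where
  "affine_map c r \<equiv> (\<lambda>x. c + r *\<^sub>R x)"

lemma gag_kernel_measurable [measurable]:
  assumes [measurable]: "v \<in> borel_measurable borel" "f \<in> borel_measurable M" "g \<in> borel_measurable M"
  shows "(\<lambda>x. gag_kernel p v (f x) (g x)) \<in> borel_measurable M"
  unfolding gag_kernel_def by measurable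

lemma gag_kernel_commute: "gag_kernel p v x y = gag_kernel p v y x"
  by (simp add: gag_kernel_def dist_commute abs_minus_commute)

lemma energy_gagliardo:
  fixes u :: "real^2 \<Rightarrow> real"
  assumes "s * p = 1" "p > 0"
  shows "ennpowr (gagliardo_seminorm s p G u) p = energy p G u"
  using assms
  by (simp add: gagliardo_seminorm_def cross_energy_def gag_kernel_def ennpowr_inverse_exponent)

lemma cross_energy_cong:
  assumes "\<And>x. x \<in> A \<union> B \<Longrightarrow> u x = v x"
  shows "cross_energy p A B u = cross_energy p A B v"
  unfolding cross_energy_def gag_kernel_def
  by (intro nn_integral_cong) (use assms in \<open>auto simp: indicator_def intro!: nn_integral_cong\<close>)

lemma cross_energy_mono:
  assumes "A \<subseteq> A'" "B \<subseteq> B'"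
  shows "cross_energy p A B v \<le> cross_energy p A' B' v"
  unfolding cross_energy_def
  by (intro nn_integral_mono mult_mono) (use assms in \<open>auto simp: indicator_def intro!: nn_integral_mono\<close>)

text \<open>Serves to bound the energy over \<open>\<Omega>\<close> by the energy over the
  perforated domain, which differs from it by a null set.\<close>

lemma cross_energy_mono_AE:
  assumes "AE x in lborel. x \<in> A \<longrightarrow> x \<in> A'" "AE x in lborel. x \<in> B \<longrightarrow> x \<in> B'"
  shows "cross_energy p A B v \<le> cross_energy p A' B' v"
proof -
  have "(\<integral>\<^sup>+y\<in>B. gag_kernel p v x y \<partial>lborel) \<le> (\<integral>\<^sup>+y\<in>B'. gag_kernel p v x y \<partial>lborel)" for x
    by (intro nn_integral_mono_AE) (use assms(2) in \<open>auto simp: indicator_def elim!: eventually_mono\<close>)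
  then show ?thesis
    unfolding cross_energy_def
    by (intro nn_integral_mono_AE)
       (use assms(1) in \<open>auto simp: indicator_def elim!: eventually_mono\<close>)
qed

section \<open>Scaling under similarities\<close>

lemma nn_integral_affine:
  fixes f :: "real^2 \<Rightarrow> ennreal"
  assumes [measurable]: "f \<in> borel_measurable borel" and r: "r > 0"
  shows "(\<integral>\<^sup>+x. f x \<partial>lborel) = ennreal (r\<^sup>2) * (\<integral>\<^sup>+x. f (affine_map c r x) \<partial>lborel)"
  using r by (subst lborel_affine[of r c])
    (auto simp: nn_integral_density nn_integral_distr nn_integral_cmult)

lemma affine_image_measurable [measurable]:
  assumes "A \<in> sets borel" "r > 0"
  shows "affine_map c r ` A \<in> sets borel"
proof -
  have "affine_map c r ` A = (\<lambda>x. (1/r) *\<^sub>R (x - c)) -` A \<inter> space borel"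
    using assms by (force simp: image_iff)
  also have "\<dots> \<in> sets borel"
    by (rule measurable_sets) (use assms in auto)
  finally show ?thesis .
qed

lemma indicator_affine_image:
  "r > 0 \<Longrightarrow> indicator (affine_map c r ` A) (affine_map c r x) = indicator A x"
  by (auto simp: indicator_def)

lemma set_nn_integral_affine:
  fixes f :: "real^2 \<Rightarrow> ennreal"
  assumes [measurable]: "f \<in> borel_measurable borel" "A \<in> sets borel" and r: "r > 0"
  shows "(\<integral>\<^sup>+x\<in>affine_map c r ` A. f x \<partial>lborel) = ennreal (r\<^sup>2) * (\<integral>\<^sup>+x\<in>A. f (affine_map c r x) \<partial>lborel)"
proof -
  have [measurable]: "affine_map c r ` A \<in> sets borel"
    using r by (intro affine_image_measurable) auto
  show ?thesis
    by (subst nn_integral_affine[OF _ r, of _ c]) (use r in \<open>auto simp: indicator_affine_image\<close>)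
qed

lemma emeasure_affine_image:
  assumes "A \<in> sets borel" "r > 0"
  shows "emeasure lborel (affine_map c r ` A) = ennreal (r\<^sup>2) * emeasure lborel A"
  using set_nn_integral_affine[of "\<lambda>_. 1" A r c] assms affine_image_measurable[OF assms] by simp

lemma gag_kernel_affine:
  assumes "r > 0"
  shows "gag_kernel p v (affine_map c r x) (affine_map c r y)
    = ennreal (1 / r^3) * gag_kernel p (v \<circ> affine_map c r) x y"
proof -
  have "dist (affine_map c r x) (affine_map c r y) = r * dist x y"
    using assms by (simp add: dist_norm flip: scaleR_diff_right)
  then show ?thesis
    using assms by (auto simp: gag_kernel_def powr_mult powr_numeral simp flip: ennreal_mult')
qed

text \<open>Two area factors \<open>r\<^sup>2\<close> meet the kernel factor \<open>1 / r^3\<close>,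
  which leaves the power \<open>2 - s * p = 1\<close> of the scale. The comparisons of dimensions in
  the proof go back to this exponent.\<close>

lemma cross_energy_affine:
  assumes [measurable]: "v \<in> borel_measurable borel" "A \<in> sets borel" "B \<in> sets borel" and r: "r > 0"
  shows "cross_energy p (affine_map c r ` A) (affine_map c r ` B) v
    = ennreal r * cross_energy p A B (v \<circ> affine_map c r)"
proof -
  have [measurable]: "affine_map c r ` A \<in> sets borel" "affine_map c r ` B \<in> sets borel"
    using r by (auto intro!: affine_image_measurable)
  have "(\<integral>\<^sup>+y\<in>affine_map c r ` B. gag_kernel p v (affine_map c r x) y \<partial>lborel)
      = ennreal (1 / r) * (\<integral>\<^sup>+y\<in>B. gag_kernel p (v \<circ> affine_map c r) x y \<partial>lborel)" for x
  proof -
    have "(\<integral>\<^sup>+y\<in>affine_map c r ` B. gag_kernel p v (affine_map c r x) y \<partial>lborel)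
      = ennreal (r\<^sup>2) * (\<integral>\<^sup>+y\<in>B. ennreal (1 / r^3) * gag_kernel p (v \<circ> affine_map c r) x y \<partial>lborel)"
      using r by (subst set_nn_integral_affine) (auto simp: gag_kernel_affine)
    also have "\<dots> = ennreal (r\<^sup>2) * (ennreal (1 / r^3) * (\<integral>\<^sup>+y\<in>B. gag_kernel p (v \<circ> affine_map c r) x y \<partial>lborel))"
      by (subst nn_integral_cmult[symmetric]) (auto simp: mult.assoc comp_def)
    also have "\<dots> = ennreal (1 / r) * (\<integral>\<^sup>+y\<in>B. gag_kernel p (v \<circ> affine_map c r) x y \<partial>lborel)"
      using r by (simp add: mult.assoc[symmetric] power2_eq_square power3_eq_cube flip: ennreal_mult')
    finally show ?thesis .
  qed
  then have "cross_energy p (affine_map c r ` A) (affine_map c r ` B) v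
    = ennreal (r\<^sup>2) * (\<integral>\<^sup>+x\<in>A. (ennreal (1/r) * (\<integral>\<^sup>+y\<in>B. gag_kernel p (v \<circ> affine_map c r) x y \<partial>lborel)) \<partial>lborel)"
    unfolding cross_energy_def using r by (subst set_nn_integral_affine) (auto simp: comp_def)
  also have "\<dots> = ennreal (r\<^sup>2) * (ennreal (1/r) * cross_energy p A B (v \<circ> affine_map c r))"
    unfolding cross_energy_def
    by (subst nn_integral_cmult[symmetric]) (auto simp: mult.assoc comp_def)
  also have "\<dots> = ennreal r * cross_energy p A B (v \<circ> affine_map c r)"
    using r by (simp add: mult.assoc[symmetric] power2_eq_square flip: ennreal_mult')
  finally show ?thesis .
qed

text \<open>Integrating the pointwise splitting over \<open>P \<times> R\<close> compares the
  averages of \<open>\<bar>v\<bar> powr p\<close> on two sets. The distance bound makes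
  \<open>\<bar>v x - v y\<bar> powr p\<close> at most \<open>d^3\<close> times the kernel, so the
  error is a cross energy.\<close>

lemma split_average:
  assumes split: "\<And>a b :: real. \<bar>a\<bar> powr p \<le> 3/2 * \<bar>b\<bar> powr p + c * \<bar>a - b\<bar> powr p" and "p > 0" "c > 0"
    and [measurable]: "v \<in> borel_measurable borel" "P \<in> sets borel" "R \<in> sets borel"
    and d: "\<And>x y. x \<in> P \<Longrightarrow> y \<in> R \<Longrightarrow> dist x y \<le> d" 
  shows "emeasure lborel R * (\<integral>\<^sup>+x\<in>P. ennreal (\<bar>v x\<bar> powr p) \<partial>lborel)
    \<le> ennreal (3/2) * emeasure lborel P * (\<integral>\<^sup>+x\<in>R. ennreal (\<bar>v x\<bar> powr p) \<partial>lborel)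
      + ennreal (c * d^3) * cross_energy p P R v"
proof -
  have pt: "ennreal (\<bar>v x\<bar> powr p) \<le> ennreal (3/2) * ennreal (\<bar>v y\<bar> powr p) + ennreal (c * d^3) * gag_kernel p v x y"
    if "x \<in> P" "y \<in> R" for x y
  proof -
    have "\<bar>v x - v y\<bar> powr p \<le> d^3 * (\<bar>v x - v y\<bar> powr p / dist x y powr 3)"
    proof (cases "x = y")
      case False
      then have "dist x y powr 3 \<le> d^3"
        using d[OF that] by (simp add: powr_numeral power_mono)
      then show ?thesis
        using False by (simp add: field_simps mult_right_mono)
    qed (use \<open>p > 0\<close> in auto)
    then have "c * \<bar>v x - v y\<bar> powr p \<le> c * (d^3 * (\<bar>v x - v y\<bar> powr p / dist x y powr 3))"
      using \<open>c > 0\<close> by (intro mult_left_mono) auto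
    then have "\<bar>v x\<bar> powr p \<le> 3/2 * \<bar>v y\<bar> powr p + (c * d^3) * (\<bar>v x - v y\<bar> powr p / dist x y powr 3)"
      using split[of "v x" "v y"] by (simp add: mult.assoc)
    moreover have "0 \<le> d" using d[OF that] zero_le_dist[of x y] by linarith
    ultimately show ?thesis
      unfolding gag_kernel_def using \<open>c > 0\<close> 
      by (simp flip: ennreal_mult' ennreal_plus add: ennreal_leI)
  qed
  have "emeasure lborel R * (\<integral>\<^sup>+x\<in>P. ennreal (\<bar>v x\<bar> powr p) \<partial>lborel)
      = (\<integral>\<^sup>+x\<in>P. (\<integral>\<^sup>+y\<in>R. ennreal (\<bar>v x\<bar> powr p) \<partial>lborel) \<partial>lborel)"
    by (simp add: nn_integral_cmult_indicator nn_integral_cmult[symmetric]) (simp add: ac_simps)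
  also have "\<dots> \<le> (\<integral>\<^sup>+x\<in>P. (\<integral>\<^sup>+y\<in>R. (ennreal (3/2) * ennreal (\<bar>v y\<bar> powr p) + ennreal (c * d^3) * gag_kernel p v x y) \<partial>lborel) \<partial>lborel)"
    by (intro nn_integral_mono) (auto simp: indicator_def intro!: nn_integral_mono pt)
  also have "\<dots> = (\<integral>\<^sup>+x\<in>P. (ennreal (3/2) * (\<integral>\<^sup>+y\<in>R. ennreal (\<bar>v y\<bar> powr p) \<partial>lborel)
       + ennreal (c * d^3) * (\<integral>\<^sup>+y\<in>R. gag_kernel p v x y \<partial>lborel)) \<partial>lborel)"
    by (simp add: distrib_right nn_integral_add nn_integral_cmult mult.assoc)
  also have "\<dots> = ennreal (3/2) * emeasure lborel P * (\<integral>\<^sup>+x\<in>R. ennreal (\<bar>v x\<bar> powr p) \<partial>lborel)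
      + ennreal (c * d^3) * cross_energy p P R v"
    unfolding cross_energy_def
    by (simp add: distrib_right nn_integral_add nn_integral_cmult nn_integral_cmult_indicator mult.assoc)
       (simp add: nn_integral_cmult_indicator ac_simps)
  finally show ?thesis .
qed

section \<open>Integrals of the truncated kernel\<close>

lemma ennreal_le_suminf: "f j \<le> suminf f" for f :: "nat \<Rightarrow> ennreal"
  using sum_le_suminf[of f "{j}"] by simp


lemma power_two_swap: "((2::real)^j)^3 = 8^j" "((2::real)^j)^2 = 4^j"
proof -
  have "((2::real)^j)^n = (2^n)^j" for n by (simp only: power_mult[symmetric] mult.commute)
  from this[of 3] this[of 2] show "((2::real)^j)^3 = 8^j" "((2::real)^j)^2 = 4^j" by simp_all
qed

lemma dyadic_bracket:
  fixes x :: real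
  assumes "x \<ge> 1"
  obtains j :: nat where "2^j \<le> x" "x < 2^(Suc j)"
proof -
  define n where "n = (LEAST n. x < 2^n)"
  have "x < 2^n"
    unfolding n_def using real_arch_pow[of 2 x] by (auto intro: LeastI)
  moreover have "n \<noteq> 0"
    using calculation assms by (intro notI) auto
  then obtain j where "n = Suc j" by (auto simp: gr0_conv_Suc)
  moreover from this have "\<not> x < 2^j"
    using not_less_Least[of j "\<lambda>n. x < 2^n"] unfolding n_def by auto
  ultimately show ?thesis by (intro that[of j]) auto
qed

lemma emeasure_ball_scale:
  assumes "r > 0"
  shows "emeasure lborel (ball (0::real^2) r) = ennreal (r\<^sup>2) * emeasure lborel (ball (0::real^2) 1)"
proof -
  have "ball 0 r = affine_map 0 r ` ball 0 1"
    using assms ball_scale[of r "0::real^2" 1] by simp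
  then show ?thesis
    using assms by (simp only:) (subst emeasure_affine_image; simp)
qed

text \<open>Dyadic shells: near radius \<open>2^j\<close> the kernel is at most
  \<open>1 / 8^j\<close> on an area of order \<open>4^j\<close>, and near radius
  \<open>1 / 2^j\<close> it is of order \<open>2 powr (j * (3 - p))\<close> on an area of order
  \<open>1 / 4^j\<close>. Both series are geometric; the second has ratio
  \<open>2 powr (1 - p)\<close>, and there \<open>p > 1\<close> enters.\<close>

lemma kernel_integral_finite:
  assumes "p > 1"
  shows "(\<integral>\<^sup>+w. ennreal (min 1 (norm w) powr p / norm (w::real^2) powr 3) \<partial>lborel) < \<infinity>"
proof -
  define \<beta> where "\<beta> = emeasure lborel (ball (0::real^2) 1)"
  have \<beta>: "\<beta> < \<infinity>" unfolding \<beta>_def using emeasure_bounded_finite[of "ball (0::real^2) 1"] by simp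
  define q where "q = (2::real) powr (1 - p)"
  have q: "0 < q" "q < 1" using assms by (auto simp: q_def powr_less_one)
  \<comment> \<open>\<open>4 * q = 2 powr (3 - p)\<close> is the growth of the kernel from one inner
    shell to the next; the factor 8 appears because \<open>norm w\<close> may be nearly half of
    \<open>1/2^j\<close> in the cubed denominator.\<close>
  define a b :: "nat \<Rightarrow> real" where "a j = 1 / 8^j" and "b j = 8 * (4 * q) ^ j" for j
  define F where "F = (\<lambda>w::real^2. (\<Sum>j. ennreal (a j) * indicator (ball 0 (2^Suc j)) w)
     + (\<Sum>j. ennreal (b j) * indicator (cball 0 (1/2^j)) w))"
  have le: "ennreal (min 1 (norm w) powr p / norm w powr 3) \<le> F w" for w :: "real^2"
  proof -
    consider "w = 0" | "norm w \<ge> 1" | "0 < norm w" "norm w < 1" by force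
    then show ?thesis
    proof cases
      case 2
      then obtain j where j: "2^j \<le> norm w" "norm w < 2^Suc j" by (rule dyadic_bracket)
      have "(2^j)^3 \<le> norm w ^ 3" using j by (intro power_mono) auto
      also have "(2^j)^3 = (8::real)^j" by (rule power_two_swap)
      finally have "1 / norm w powr 3 \<le> a j"
        using frac_le[of 1 1 "8^j" "norm w ^ 3"] 2 by (simp add: a_def powr_numeral)
      then have "ennreal (min 1 (norm w) powr p / norm w powr 3) 
          \<le> ennreal (a j) * indicator (ball 0 (2^Suc j)) w"
        using 2 j by (auto intro!: ennreal_leI)
      also have "\<dots> \<le> (\<Sum>j. ennreal (a j) * indicator (ball 0 (2^Suc j)) w)"
        by (rule ennreal_le_suminf[where f = "\<lambda>j. _ j * indicator (_ j) w"])
      finally show ?thesis unfolding F_def by (meson add_increasing2 zero_le)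
    next
      case 3
      then have "1 / norm w \<ge> 1" by simp
      then obtain j where j: "2^j \<le> 1 / norm w" "1 / norm w < 2^Suc j" by (rule dyadic_bracket)
      have w: "norm w \<le> 1 / 2^j" "1 / 2^Suc j < norm w"
        using j 3 by (auto simp: field_simps)
      have "norm w powr p \<le> (1 / 2^j) powr p"
        using w assms by (intro powr_mono2) auto
      moreover have "(1 / 2^Suc j)^3 \<le> norm w ^ 3" using w by (intro power_mono) auto
      ultimately have "norm w powr p / norm w powr 3 \<le> (1 / 2^j) powr p / (1 / 2^Suc j)^3"
        using 3 by (auto simp: powr_numeral intro!: frac_le)
      also have "\<dots> = b j"
      proof -
        have "(1 / 2^j) powr p = (q / 2) ^ j"
          by (simp add: q_def powr_diff powr_divide powr_power powr_realpow[symmetric] powr_powr power_divide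
            mult.commute powr_minus_divide)
        moreover have "((1::real) / 2^Suc j)^3 = 1 / (8 * 8^j)"
          by (simp add: power_divide power_mult_distrib power_two_swap)
        moreover have "(q / 2) ^ j * 8^j = (4 * q) ^ j"
          unfolding power_mult_distrib[symmetric] by simp
        ultimately show ?thesis by (simp add: b_def)
      qed
      finally have "ennreal (min 1 (norm w) powr p / norm w powr 3) 
          \<le> ennreal (b j) * indicator (cball 0 (1/2^j)) w"
        using 3 w by (auto intro!: ennreal_leI)
      also have "\<dots> \<le> (\<Sum>j. ennreal (b j) * indicator (cball 0 (1/2^j)) w)"
        by (rule ennreal_le_suminf[where f = "\<lambda>j. _ j * indicator (_ j) w"])
      finally show ?thesis unfolding F_def by (meson add_increasing zero_le)
    qed auto
  qed
  have "(\<integral>\<^sup>+w. F w \<partial>lborel) = (\<Sum>j. ennreal (a j) * emeasure lborel (ball (0::real^2) (2^Suc j)))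
      + (\<Sum>j. ennreal (b j) * emeasure lborel (cball (0::real^2) (1/2^j)))"
    unfolding F_def
    by (subst nn_integral_add; (subst nn_integral_suminf)?; (subst nn_integral_suminf)?)
       (auto simp: nn_integral_cmult_indicator
         intro!: borel_measurable_suminf_order borel_measurable_times_ennreal borel_measurable_indicator)
  also have "\<dots> \<le> (\<Sum>j. ennreal (4 * (1/2)^j) * \<beta>) + (\<Sum>j. ennreal (32 * q^j) * \<beta>)"
  proof (intro add_mono suminf_le ballI allI)
    fix j
    have "ennreal (a j) * emeasure lborel (ball (0::real^2) (2^Suc j))
      = ennreal (a j * (2^Suc j)\<^sup>2) * \<beta>"
      unfolding \<beta>_def by (subst emeasure_ball_scale)
        (simp_all add: mult.assoc[symmetric] a_def del: power_Suc flip: ennreal_mult')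
    also have "a j * (2^Suc j)\<^sup>2 = 4 * (1/2)^j"
      using power_mult_distrib[of "4::real" 2 j]
      by (simp add: a_def power_mult_distrib power_divide power_two_swap)
    finally show "ennreal (a j) * emeasure lborel (ball (0::real^2) (2^Suc j)) \<le> ennreal (4 * (1/2)^j) * \<beta>"
      by simp
    have "ennreal (b j) * emeasure lborel (cball (0::real^2) (1/2^j))
      \<le> ennreal (b j) * emeasure lborel (ball (0::real^2) (2/2^j))"
      by (intro mult_left_mono emeasure_mono) (simp_all add: cball_subset_ball_iff divide_strict_right_mono)
    also have "\<dots> = ennreal (b j * (2/2^j)\<^sup>2) * \<beta>"
      unfolding \<beta>_def using q by (subst emeasure_ball_scale)
        (simp_all add: mult.assoc[symmetric] b_def flip: ennreal_mult')
    also have "b j * (2/2^j)\<^sup>2 = 32 * q^j"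
      by (simp add: b_def power_mult_distrib power_divide power_two_swap)
    finally show "ennreal (b j) * emeasure lborel (cball (0::real^2) (1/2^j)) \<le> ennreal (32 * q^j) * \<beta>" .
  qed auto
  also have "\<dots> = ennreal (\<Sum>j. 4 * (1/2)^j) * \<beta> + ennreal (\<Sum>j. 32 * q^j) * \<beta>"
    using q by (simp add: suminf_ennreal2 summable_mult summable_geometric)
  also have "\<dots> < \<infinity>" using \<beta> by (simp add: ennreal_mult_less_top)
  finally show ?thesis
    by (rule le_less_trans[rotated]) (intro nn_integral_mono le)
qed

text \<open>The substitution \<open>w = L * (y - x)\<close> produces
  \<open>L^3 / L\<^sup>2 = L\<close>. For a function with values in the unit interval and Lipschitz
  constant \<open>L\<close> the truncated kernel dominates \<open>gag_kernel\<close>, so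
  \<open>C * L\<close> bounds its energy per unit area.\<close>

lemma kernel_integral_bound:
  assumes "p > 1"
  obtains C where "C > 0"
    "\<And>L (x::real^2). L > 0 \<Longrightarrow> (\<integral>\<^sup>+y. ennreal (min 1 (L * dist x y) powr p / dist x y powr 3) \<partial>lborel) \<le> ennreal (C * L)"
proof -
  define I where "I = (\<integral>\<^sup>+w. ennreal (min 1 (norm w) powr p / norm (w::real^2) powr 3) \<partial>lborel)"
  have fin: "I < \<infinity>" unfolding I_def by (rule kernel_integral_finite[OF assms])
  show ?thesis
  proof
    show "enn2real I + 1 > 0" by (simp add: add_nonneg_pos)
    fix L :: real and x :: "real^2" assume L: "L > 0"
    have "(\<integral>\<^sup>+y. ennreal (min 1 (L * dist x y) powr p / dist x y powr 3) \<partial>lborel)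
      = ennreal ((1/L)\<^sup>2) * (\<integral>\<^sup>+w. ennreal (min 1 (L * dist x (affine_map x (1/L) w)) powr p / dist x (affine_map x (1/L) w) powr 3) \<partial>lborel)"
      using L by (intro nn_integral_affine) auto
    also have "(\<integral>\<^sup>+w. ennreal (min 1 (L * dist x (affine_map x (1/L) w)) powr p / dist x (affine_map x (1/L) w) powr 3) \<partial>lborel)
      = (\<integral>\<^sup>+w. ennreal (L^3) * ennreal (min 1 (norm w) powr p / norm (w::real^2) powr 3) \<partial>lborel)"
      using L by (intro nn_integral_cong)
        (auto simp: dist_norm powr_divide powr_numeral simp flip: ennreal_mult')
    also have "\<dots> = ennreal (L^3) * I" unfolding I_def by (rule nn_integral_cmult) simp
    also have "ennreal ((1/L)\<^sup>2) * \<dots> = ennreal L * I"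
      using L by (simp add: mult.assoc[symmetric] power2_eq_square power3_eq_cube flip: ennreal_mult')
    also have "\<dots> = ennreal (enn2real I * L)"
      using fin L by (cases I) (auto simp: mult.commute simp flip: ennreal_mult')
    also have "\<dots> \<le> ennreal ((enn2real I + 1) * L)"
      using L by (intro ennreal_leI) (simp add: mult_right_mono)
    finally show "(\<integral>\<^sup>+y. ennreal (min 1 (L * dist x y) powr p / dist x y powr 3) \<partial>lborel) \<le> ennreal ((enn2real I + 1) * L)" .
  qed
qed

section \<open>Poincare inequality on Cantor cylinders\<close>

lemma mem_unit_square:
  "z \<in> box 0 (1::real^2) \<longleftrightarrow> 0 < z$1 \<and> z$1 < 1 \<and> 0 < z$2 \<and> z$2 < 1"
  "z \<in> cbox 0 (1::real^2) \<longleftrightarrow> 0 \<le> z$1 \<and> z$1 \<le> 1 \<and> 0 \<le> z$2 \<and> z$2 \<le> 1"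
  by (auto simp: mem_box_cart forall_2)

lemma emeasure_rectangle:
  fixes a b :: "real^2"
  assumes "a$1 \<le> b$1" "a$2 \<le> b$2"
  shows "emeasure lborel (cbox a b) = ennreal ((b$1 - a$1) * (b$2 - a$2))"
    "emeasure lborel (box a b) = ennreal ((b$1 - a$1) * (b$2 - a$2))"
proof -
  have *: "cbox a b \<noteq> {}" using assms by (auto simp: interval_ne_empty_cart forall_2)
  have "measure lborel (cbox a b) = (b$1 - a$1) * (b$2 - a$2)"
    using content_cbox_cart[OF *] by (simp add: sum_2 prod_2 UNIV_2)
  then show "emeasure lborel (cbox a b) = ennreal ((b$1 - a$1) * (b$2 - a$2))"
    using emeasure_lborel_cbox_finite[of a b] by (simp add: emeasure_eq_ennreal_measure less_top)
  moreover have "emeasure lborel (box a b) = emeasure lborel (cbox a b)"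
    using * by (simp add: emeasure_lborel_box_eq emeasure_lborel_cbox_eq)
  ultimately show "emeasure lborel (box a b) = ennreal ((b$1 - a$1) * (b$2 - a$2))" by simp
qed

lemma emeasure_unit_square: "emeasure lborel (box 0 (1::real^2)) = 1"
  by (simp add: emeasure_rectangle)

lemma dist_vec2_le: "dist x y \<le> \<bar>x$1 - y$1\<bar> + \<bar>x$2 - y$2\<bar>" for x y :: "real^2"
  using norm_le_l1_cart[of "x - y"] by (simp add: dist_norm sum_2)

lemma dist_vec2_ge: "\<bar>x$i - y$i\<bar> \<le> dist x y" for x y :: "real^2"
  using component_le_norm_cart[of "x - y" i] by (simp add: dist_norm)

text \<open>The blocks \<open>A i \<times> A i\<close> are disjoint parts of
  \<open>B \<times> B\<close>; the mixed blocks are discarded. Writing the sum as an integral over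
  \<open>count_space\<close> lets it be exchanged with the Lebesgue integral without an enumeration
  of \<open>I\<close>.\<close>

lemma disjoint_energy_le:
  assumes "countable I" "disjoint_family_on A I" and sub: "\<And>i. i \<in> I \<Longrightarrow> A i \<subseteq> B"
    and [measurable]: "\<And>i. i \<in> I \<Longrightarrow> A i \<in> sets borel" "v \<in> borel_measurable borel"
  shows "(\<integral>\<^sup>+i. energy p (A i) v \<partial>count_space I) \<le> energy p B v"
proof -
  have "(\<integral>\<^sup>+i. energy p (A i) v \<partial>count_space I)
    = (\<integral>\<^sup>+x. (\<integral>\<^sup>+i. (\<integral>\<^sup>+y\<in>A i. gag_kernel p v x y \<partial>lborel) * indicator (A i) x \<partial>count_space I) \<partial>lborel)"
    unfolding cross_energy_def
    by (rule nn_integral_count_space_nn_integral[symmetric]) (use assms(1) in auto)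
  also have "\<dots> \<le> energy p B v"
    unfolding cross_energy_def
  proof (intro nn_integral_mono)
    fix x
    show "(\<integral>\<^sup>+i. (\<integral>\<^sup>+y\<in>A i. gag_kernel p v x y \<partial>lborel) * indicator (A i) x \<partial>count_space I)
      \<le> (\<integral>\<^sup>+y\<in>B. gag_kernel p v x y \<partial>lborel) * indicator B x"
    proof (cases "\<exists>j\<in>I. x \<in> A j")
      case True
      then obtain j where j: "j \<in> I" "x \<in> A j" by auto
      have "i = j" if "i \<in> I" "x \<in> A i" for i
        using that j assms(2) by (auto simp: disjoint_family_on_def)
      then have "(\<integral>\<^sup>+i. (\<integral>\<^sup>+y\<in>A i. gag_kernel p v x y \<partial>lborel) * indicator (A i) x \<partial>count_space I)
        \<le> (\<integral>\<^sup>+i. (\<integral>\<^sup>+y\<in>B. gag_kernel p v x y \<partial>lborel) * indicator {j} i \<partial>count_space I)"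
        using sub by (intro nn_integral_mono mult_mono) (auto simp: indicator_def intro!: nn_integral_mono)
      also have "\<dots> = (\<integral>\<^sup>+y\<in>B. gag_kernel p v x y \<partial>lborel)"
        using j by (subst nn_integral_cmult_indicator) auto
      finally show ?thesis using j sub by (auto simp: indicator_def)
    next
      case False
      then have "(\<integral>\<^sup>+i. (\<integral>\<^sup>+y\<in>A i. gag_kernel p v x y \<partial>lborel) * indicator (A i) x \<partial>count_space I)
        = (\<integral>\<^sup>+i. 0 \<partial>count_space I)" by (intro nn_integral_cong) auto
      then show ?thesis by simp
    qed
  qed
  finally show ?thesis .
qed

lemma sum_disjoint_energy_le:
  assumes "finite I" "disjoint_family_on A I" "\<And>i. i \<in> I \<Longrightarrow> A i \<subseteq> B"
    "\<And>i. i \<in> I \<Longrightarrow> A i \<in> sets borel" "v \<in> borel_measurable borel"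
  shows "(\<Sum>i\<in>I. energy p (A i) v) \<le> energy p B v"
  using disjoint_energy_le[of I A B v p] assms
  by (simp add: nn_integral_count_space_finite countable_finite)

abbreviation power_integral :: "real \<Rightarrow> (real^2) set \<Rightarrow> (real^2 \<Rightarrow> real) \<Rightarrow> ennreal" where
  "power_integral p A v \<equiv> (\<integral>\<^sup>+x\<in>A. ennreal (\<bar>v x\<bar> powr p) \<partial>lborel)"

lemma box_sets_borel [measurable]: "box a b \<in> sets borel" "cbox a b \<in> sets borel"
  by auto

text \<open>Transfers a bound from a small square, where more is known about \<open>v\<close>, to
  the whole unit square. The 8 is the cube of the distance bound 2.\<close>

lemma subsquare_average:
  assumes "p > 0" "c > 0" "r > 0" and [measurable]: "v \<in> borel_measurable borel"
    and split: "\<And>a b :: real. \<bar>a\<bar> powr p \<le> 3/2 * \<bar>b\<bar> powr p + c * \<bar>a - b\<bar> powr p"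
    and sub: "affine_map d r ` box 0 1 \<subseteq> box 0 1"
  shows "ennreal (r\<^sup>2) * power_integral p (box 0 1) v
    \<le> ennreal (3/2 * r\<^sup>2) * power_integral p (box 0 1) (v \<circ> affine_map d r)
      + ennreal (8 * c) * energy p (box 0 1) v"
proof -
  have dist2: "dist x y \<le> 2" if "x \<in> box 0 1" "y \<in> box 0 1" for x y :: "real^2"
    using dist_vec2_le[of x y] that by (auto simp: mem_unit_square)
  let ?R = "affine_map d r ` box 0 1"
  have R: "?R \<in> sets borel" using \<open>r > 0\<close> by (intro affine_image_measurable) auto
  have "emeasure lborel ?R * power_integral p (box 0 1) v
    \<le> ennreal (3/2) * emeasure lborel (box 0 (1::real^2)) * power_integral p ?R v
      + ennreal (c * 2^3) * cross_energy p (box 0 1) ?R v"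
    using dist2 sub by (intro split_average[OF split assms(1,2)]) (auto intro: R)
  also have "cross_energy p (box 0 1) ?R v \<le> energy p (box 0 1) v"
    using sub by (intro cross_energy_mono) auto
  also have "power_integral p ?R v = ennreal (r\<^sup>2) * power_integral p (box 0 1) (v \<circ> affine_map d r)"
    using \<open>r > 0\<close> by (subst set_nn_integral_affine) auto
  also have "emeasure lborel ?R = ennreal (r\<^sup>2)"
    using \<open>r > 0\<close> by (subst emeasure_affine_image) (auto simp: emeasure_unit_square)
  finally show ?thesis
    using ennreal_mult[of "3/2" "r\<^sup>2"]
    by (simp add: emeasure_unit_square mult.assoc mult.commute[of c] add_left_mono mult_left_mono)
qed

primrec cantor_level :: "nat \<Rightarrow> real set" where
  "cantor_level 0 = {0..1}"
| "cantor_level (Suc k) = (\<lambda>x. x / 3) ` cantor_level k \<union> (\<lambda>x. (x + 2) / 3) ` cantor_level k"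

text \<open>These approximants have positive area. Level 0 is the whole closed square, where
  \<open>v = 0\<close> makes the Poincare inequality trivial; this is what starts the induction on
  the level.\<close>

definition cantor_strip :: "nat \<Rightarrow> (real^2) set" where
  "cantor_strip k = {z. z$1 \<in> cantor_level k \<and> z$2 \<in> {0..1}}"

text \<open>At each step the passage to the six subsquares costs a factor \<open>3/2\<close> in the average of
  \<open>\<bar>v\<bar>\<^sup>p\<close>, while the energies gain a factor \<open>3 / 6\<close>: six subsquares beat the scale \<open>3\<close> because
  the strips have dimension larger than \<open>1\<close>. The product \<open>3/4\<close> makes the constant independent
  of \<open>k\<close>.\<close>

lemma cantor_poincare:
  assumes "p > 0"
  obtains A where "A > 0"
    "\<And>k v. v \<in> borel_measurable borel \<Longrightarrow> (\<And>z. z \<in> cantor_strip k \<Longrightarrow> v z = 0)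
       \<Longrightarrow> power_integral p (box 0 1) v \<le> ennreal A * energy p (box 0 1) v"
proof -
  obtain c where c: "c > 0" and
    split: "\<And>a b :: real. \<bar>a\<bar> powr p \<le> 3/2 * \<bar>b\<bar> powr p + c * \<bar>a - b\<bar> powr p"
    using powr_split[OF assms] by blast
  \<comment> \<open>The solution of \<open>A / 2 + 48 * c = 2/3 * A\<close>: the 48 collects six
    error terms \<open>8 * c\<close>, and \<open>2/3 = 6/9\<close> is the total area of the six
    subsquares on the left-hand side.\<close>
  define A where "A = 288 * c"
  have A: "A > 0" using c by (simp add: A_def)
  have "power_integral p (box 0 1) v \<le> ennreal A * energy p (box 0 1) v"
    if "v \<in> borel_measurable borel" "\<And>z. z \<in> cantor_strip k \<Longrightarrow> v z = 0" for k v
    using that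
  proof (induction k arbitrary: v)
    case 0
    have "power_integral p (box 0 1) v = (\<integral>\<^sup>+(x::real^2). 0 \<partial>lborel)"
      using 0(2) by (intro nn_integral_cong)
        (auto simp: indicator_def cantor_strip_def mem_unit_square intro!: less_imp_le)
    then show ?case by simp
  next
    case (Suc k)
    note [measurable] = Suc.prems(1)
    let ?U = "box 0 (1::real^2)"
    \<comment> \<open>Columns 0 and 2 are those that the Cantor construction keeps, each with all
      three rows: six triadic subsquares.\<close>
    define I :: "(real \<times> real) set" where "I = {0, 2} \<times> {0, 1, 2}"
    define d :: "real \<times> real \<Rightarrow> real^2" where "d i = vector [fst i / 3, snd i / 3]" for i
    let ?\<phi> = "\<lambda>i. affine_map (d i) (1/3)"
    have card: "card I = 6" "finite I" by (auto simp: I_def)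
    have comp: "(?\<phi> i z)$1 = (z$1 + fst i) / 3" "(?\<phi> i z)$2 = (z$2 + snd i) / 3" for i z
      by (auto simp: d_def)
    have sub: "?\<phi> i ` ?U \<subseteq> ?U" if "i \<in> I" for i
      using that by (auto simp: mem_unit_square comp I_def simp del: vector_add_component)
    have meas: "?\<phi> i ` ?U \<in> sets borel" for i by (intro affine_image_measurable) auto
    have disj: "disjoint_family_on (\<lambda>i. ?\<phi> i ` ?U) I"
    proof (unfold disjoint_family_on_def, intro ballI impI)
      fix i j assume ij: "i \<in> I" "j \<in> I" "i \<noteq> j"
      show "?\<phi> i ` ?U \<inter> ?\<phi> j ` ?U = {}"
      proof (rule ccontr)
        assume "?\<phi> i ` ?U \<inter> ?\<phi> j ` ?U \<noteq> {}"
        then obtain x y where xy: "x \<in> ?U" "y \<in> ?U" "?\<phi> i x = ?\<phi> j y" by blast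
        then have "x$1 + fst i = y$1 + fst j" "x$2 + snd i = y$2 + snd j"
          using comp[of i x] comp[of j y] by auto
        then show False using xy(1,2) ij by (auto simp: I_def mem_unit_square)
      qed
    qed
    have IH: "power_integral p ?U (v \<circ> ?\<phi> i) \<le> ennreal A * energy p ?U (v \<circ> ?\<phi> i)" if "i \<in> I" for i
    proof (rule Suc.IH)
      fix z assume "z \<in> cantor_strip k"
      then have "?\<phi> i z \<in> cantor_strip (Suc k)"
        using that unfolding cantor_strip_def mem_Collect_eq comp by (auto simp: I_def)
      then show "(v \<circ> ?\<phi> i) z = 0" using Suc.prems(2) by simp
    qed simp
    have "ennreal (2/3) * power_integral p ?U v = (\<Sum>i\<in>I. ennreal ((1/3)\<^sup>2) * power_integral p ?U v)"
      using card by (simp add: ennreal_of_nat_eq_real_of_nat mult.assoc[symmetric] power2_eq_square 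
          flip: ennreal_mult' ennreal_numeral)
    also have "\<dots> \<le> (\<Sum>i\<in>I. ennreal (3/2 * (1/3)\<^sup>2) * power_integral p ?U (v \<circ> ?\<phi> i)
        + ennreal (8 * c) * energy p ?U v)"
      using sub c assms by (intro sum_mono subsquare_average split) auto
    also have "\<dots> \<le> (\<Sum>i\<in>I. ennreal (3/2 * (1/3)\<^sup>2) * (ennreal A * energy p ?U (v \<circ> ?\<phi> i))
        + ennreal (8 * c) * energy p ?U v)"
      using IH by (intro sum_mono add_right_mono mult_left_mono) auto
    also have "\<dots> = (\<Sum>i\<in>I. ennreal (A / 2) * energy p (?\<phi> i ` ?U) v) + ennreal (48 * c) * energy p ?U v"
    proof -
      \<comment> \<open>Moving the energy back to the subsquare gains a factor 3, and
        \<open>3/2 * 1/9 * 3 = 1/2\<close>.\<close>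
      have "energy p (?\<phi> i ` ?U) v = ennreal (1/3) * energy p ?U (v \<circ> ?\<phi> i)" for i
        by (rule cross_energy_affine) auto
      then have "ennreal (3/2 * (1/3)\<^sup>2) * (ennreal A * energy p ?U (v \<circ> ?\<phi> i))
          = ennreal (A / 2) * energy p (?\<phi> i ` ?U) v" for i
        using A by (simp add: mult.assoc[symmetric] power2_eq_square flip: ennreal_mult)
      moreover have "(\<Sum>i\<in>I. ennreal (8 * c) * energy p ?U v) = ennreal (48 * c) * energy p ?U v"
        using card c by (simp add: ennreal_of_nat_eq_real_of_nat mult.assoc[symmetric] 
          flip: ennreal_mult ennreal_numeral)
      ultimately show ?thesis by (simp add: sum.distrib)
    qed
    also have "\<dots> \<le> ennreal (A / 2) * energy p ?U v + ennreal (48 * c) * energy p ?U v"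
      unfolding sum_distrib_left[symmetric]
      using sub meas disj card by (intro add_right_mono mult_left_mono sum_disjoint_energy_le) auto
    also have "\<dots> = ennreal (2/3 * A) * energy p ?U v"
      using c by (simp add: A_def flip: distrib_right ennreal_plus)
    finally have "ennreal (3/2) * (ennreal (2/3) * power_integral p ?U v)
        \<le> ennreal (3/2) * (ennreal (2/3 * A) * energy p ?U v)"
      by (rule mult_left_mono) simp
    then show ?case
      using A by (simp add: mult.assoc[symmetric] flip: ennreal_mult)
  qed
  then show ?thesis using A that by blast
qed

section \<open>The limit Cantor set and the hole in the unit square\<close>

lemma compact_cantor_level: "compact (cantor_level k)"
  by (induction k) (auto intro!: compact_Un compact_continuous_image continuous_intros)

lemma cantor_level_subset: "cantor_level k \<subseteq> {0..1}"
proof (induction k)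
  case (Suc k)
  then show ?case by (fastforce simp: image_iff)
qed simp

lemma cantor_level_Suc_subset: "cantor_level (Suc k) \<subseteq> cantor_level k"
proof (induction k)
  case (Suc k)
  then show ?case by (simp only: cantor_level.simps) blast
qed auto

definition cantor_set :: "real set" where
  "cantor_set = (\<Inter>k. cantor_level k)"

lemma compact_cantor_set: "compact cantor_set"
proof -
  have "closed cantor_set"
    unfolding cantor_set_def by (intro closed_INT ballI compact_imp_closed compact_cantor_level)
  moreover have "cantor_set \<subseteq> {0..1}"
    unfolding cantor_set_def using cantor_level_subset by blast
  ultimately show ?thesis
    by (meson bounded_closed_interval bounded_subset compact_eq_bounded_closed)
qed

lemma cantor_set_subset: "cantor_set \<subseteq> {0..1}"
  using cantor_level_subset unfolding cantor_set_def by blast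

text \<open>The branch could depend on the level. As the two outer thirds are disjoint, the position
  of \<open>x\<close> relative to \<open>1/3\<close> selects the same branch at all levels, and the
  choice passes to the intersection.\<close>

lemma cantor_set_self_similar:
  assumes "x \<in> cantor_set"
  shows "3 * x \<in> cantor_set \<or> 3 * x - 2 \<in> cantor_set"
proof -
  have lev: "x \<in> cantor_level (Suc k)" for k
    using assms unfolding cantor_set_def by blast
  have branch: "x \<le> 1/3 \<and> 3 * x \<in> cantor_level k \<or> x > 1/3 \<and> 3 * x - 2 \<in> cantor_level k" for k
  proof -
    obtain y where y: "y \<in> cantor_level k" "3 * x = y \<or> 3 * x = y + 2"
      using lev[of k] by auto
    then have "0 \<le> y" "y \<le> 1" using cantor_level_subset[of k] by auto
    then show ?thesis using y by auto
  qed
  show ?thesis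
    using branch unfolding cantor_set_def by (cases "x \<le> 1/3") auto
qed

definition cantor_cylinder :: "(real^2) set" where
  "cantor_cylinder = {z. z$1 \<in> cantor_set \<and> z$2 \<in> {0..1}}"

lemma closed_product: "closed A \<Longrightarrow> closed B \<Longrightarrow> closed {z::real^2. z$1 \<in> A \<and> z$2 \<in> B}"
  by (intro closed_Collect_conj closed_vimage[unfolded vimage_def] continuous_intros)

text \<open>Six copies at scale \<open>1/3\<close> cover the cylinder, so its finite measure
  satisfies \<open>m \<le> 6/9 * m\<close> and must be 0.\<close>

lemma cantor_cylinder_null: "cantor_cylinder \<in> null_sets lborel"
proof -
  have meas: "cantor_cylinder \<in> sets borel"
    unfolding cantor_cylinder_def
    by (intro borel_closed closed_product compact_imp_closed compact_cantor_set) auto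
  define m where "m = emeasure lborel cantor_cylinder"
  have "m \<le> emeasure lborel (cbox 0 (1::real^2))"
    unfolding m_def using cantor_set_subset
    by (intro emeasure_mono) (auto simp: cantor_cylinder_def mem_unit_square)
  then have fin: "m < \<infinity>" by (simp add: emeasure_rectangle le_less_trans)
  define I :: "(real \<times> real) set" where "I = {0, 2} \<times> {0, 1, 2}"
  define d :: "real \<times> real \<Rightarrow> real^2" where "d i = vector [fst i / 3, snd i / 3]" for i
  let ?\<phi> = "\<lambda>i. affine_map (d i) (1/3)"
  have "cantor_cylinder \<subseteq> (\<Union>i\<in>I. ?\<phi> i ` cantor_cylinder)"
  proof
    fix z assume z: "z \<in> cantor_cylinder"
    obtain a where a: "a \<in> {0, 2}" "3 * z$1 - a \<in> cantor_set"
      using z cantor_set_self_similar[of "z$1"] unfolding cantor_cylinder_def by force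
    obtain b :: real where b: "b \<in> {0, 1, 2}" "3 * z$2 - b \<in> {0..1}"
    proof -
      have "z$2 \<in> {0..1}" using z by (simp add: cantor_cylinder_def)
      then consider "3 * z$2 - 0 \<in> {0..1}" | "3 * z$2 - 1 \<in> {0..1}" | "3 * z$2 - 2 \<in> {0..1}"
        by fastforce
      then show ?thesis using that[of 0] that[of 1] that[of 2] by cases auto
    qed
    define w :: "real^2" where "w = vector [3 * z$1 - a, 3 * z$2 - b]"
    have "w \<in> cantor_cylinder" using a b by (simp add: w_def cantor_cylinder_def)
    moreover have "z = ?\<phi> (a, b) w"
      by (simp add: vec_eq_iff forall_2 w_def d_def field_simps)
    ultimately show "z \<in> (\<Union>i\<in>I. ?\<phi> i ` cantor_cylinder)"
      using a b unfolding I_def by blast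
  qed
  then have "m \<le> emeasure lborel (\<Union>i\<in>I. ?\<phi> i ` cantor_cylinder)"
    unfolding m_def using meas
    by (intro emeasure_mono) (auto simp: I_def intro!: affine_image_measurable sets.Un)
  also have "\<dots> \<le> (\<Sum>i\<in>I. emeasure lborel (?\<phi> i ` cantor_cylinder))"
    using meas by (intro emeasure_subadditive_finite) (auto simp: I_def intro!: affine_image_measurable)
  also have "\<dots> = (\<Sum>i\<in>I. ennreal ((1/3)\<^sup>2) * m)"
    unfolding m_def using meas by (intro sum.cong emeasure_affine_image) auto
  also have "\<dots> = ennreal (2/3) * m"
    by (simp add: I_def ennreal_of_nat_eq_real_of_nat mult.assoc[symmetric] power2_eq_square 
        flip: ennreal_mult' ennreal_numeral)
  finally have "m = 0"
    using fin by (cases m) (auto simp flip: ennreal_mult')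
  then show ?thesis using meas unfolding m_def by auto
qed

text \<open>Compressing the Cantor set into the middle third keeps the hole away from the sides of
  the square and leaves the abscissae below \<open>1/3\<close> to the single column
  \<open>1/6\<close>.\<close>

definition hole_columns :: "real set" where
  "hole_columns = insert (1/6) ((\<lambda>x. (x + 1) / 3) ` cantor_set)"

text \<open>The part over the Cantor set makes zero boundary values visible; the isolated segment over
  \<open>1/6\<close> has zero capacity and is the place where quasiadditivity fails.\<close>

definition unit_hole :: "(real^2) set" where
  "unit_hole = {z. z$1 \<in> hole_columns \<and> z$2 \<in> {1/3..2/3}}"

lemma hole_columns_subset: "hole_columns \<subseteq> insert (1/6) {1/3..2/3}"
  using cantor_set_subset unfolding hole_columns_def by auto

lemma unit_hole_bounds:
  assumes "z \<in> unit_hole"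
  shows "1/6 \<le> z$i" "z$i \<le> 2/3"
  using assms hole_columns_subset exhaust_2[of i] unfolding unit_hole_def by auto

lemma compact_unit_hole: "compact unit_hole"
proof -
  have "closed unit_hole"
    unfolding unit_hole_def hole_columns_def
    by (intro closed_product closed_insert compact_imp_closed compact_continuous_image
        continuous_intros compact_cantor_set) auto
  moreover have "cbox 0 1 \<inter> unit_hole = unit_hole"
  proof -
    have "z \<in> cbox 0 1" if "z \<in> unit_hole" for z
      using unit_hole_bounds[OF that, of 1] unit_hole_bounds[OF that, of 2] by (simp add: mem_unit_square)
    then show ?thesis by blast
  qed
  ultimately show ?thesis by (metis compact_Int_closed compact_cbox)
qed

lemma unit_hole_null: "unit_hole \<in> null_sets lborel"
proof -
  have "affine_map (vector [1/3, 1/3]) (1/3) ` cantor_cylinder \<in> null_sets lborel"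
    using cantor_cylinder_null by (auto simp: null_sets_def emeasure_affine_image intro!: affine_image_measurable)
  moreover have "{z::real^2. z$1 = 1/6} \<in> null_sets lborel"
    using negligible_standard_hyperplane[of "axis 1 1 :: real^2" "1/6"] closed_hyperplane[of "axis 1 1 :: real^2" "1/6"]
    by (auto simp: negligible_iff_null_sets null_sets_completion_iff inner_commute cart_eq_inner_axis axis_in_Basis_iff)
  ultimately have "affine_map (vector [1/3, 1/3]) (1/3) ` cantor_cylinder \<union> {z. z$1 = 1/6} \<in> null_sets lborel"
    by (rule null_sets.Un)
  moreover have "unit_hole \<subseteq> affine_map (vector [1/3, 1/3]) (1/3) ` cantor_cylinder \<union> {z. z$1 = 1/6}"
  proof
    fix z assume z: "z \<in> unit_hole"
    show "z \<in> affine_map (vector [1/3, 1/3]) (1/3) ` cantor_cylinder \<union> {z. z$1 = 1/6}"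
    proof (cases "z$1 = 1/6")
      case False
      then obtain x where x: "x \<in> cantor_set" "z$1 = (x + 1) / 3"
        using z by (auto simp: unit_hole_def hole_columns_def)
      define w :: "real^2" where "w = vector [x, 3 * z$2 - 1]"
      have "w \<in> cantor_cylinder" "z = affine_map (vector [1/3, 1/3]) (1/3) w"
        using x z by (auto simp: w_def cantor_cylinder_def unit_hole_def vec_eq_iff forall_2 field_simps)
      then show ?thesis by blast
    qed simp
  qed
  moreover have "unit_hole \<in> sets lborel"
    using borel_closed[OF compact_imp_closed[OF compact_unit_hole]] by simp
  ultimately show ?thesis by (meson null_sets_subset)
qed

text \<open>Each point reaches the origin by two axis-parallel segments. From a column of the hole
  the height lies outside the middle third, so one moves horizontally to the left edge; from any
  other column one moves vertically to the bottom edge. Both edges are free of the hole.\<close>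

lemma connected_square_minus_hole: "connected (cbox 0 1 - unit_hole)"
proof -
  let ?X = "cbox 0 1 - unit_hole :: (real^2) set"
  have seg: "closed_segment z w \<subseteq> ?X"
    if "z \<in> cbox 0 1" "w \<in> cbox 0 1"
      and "z$1 = w$1 \<and> z$1 \<notin> hole_columns \<or> z$2 = w$2 \<and> z$2 \<notin> {1/3..2/3}" for z w
  proof
    fix x assume x: "x \<in> closed_segment z w"
    have "x \<in> cbox 0 1" using x that convex_box(1) by (meson convex_contains_segment subsetD)
    moreover obtain t where "x = (1 - t) *\<^sub>R z + t *\<^sub>R w" using x by (auto simp: in_segment)
    then have "x$i = (1 - t) * z$i + t * w$i" for i by simp
    from this[of 1] this[of 2] have "z$1 = w$1 \<Longrightarrow> x$1 = z$1" "z$2 = w$2 \<Longrightarrow> x$2 = z$2"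
      by (simp_all add: algebra_simps)
    then have "x \<notin> unit_hole" using that(3) unfolding unit_hole_def by auto
    ultimately show "x \<in> ?X" by blast
  qed
  have "\<exists>w. w \<in> cbox 0 1 \<and> closed_segment z w \<subseteq> ?X \<and> closed_segment w 0 \<subseteq> ?X" if z: "z \<in> ?X" for z
  proof (cases "z$1 \<in> hole_columns")
    case True
    have "0 \<notin> hole_columns" using hole_columns_subset by auto
    then show ?thesis using True z
      by (intro exI[of _ "vector [0, z$2]"] conjI seg) (auto simp: mem_unit_square unit_hole_def)
  next
    case False
    then show ?thesis using z
      by (intro exI[of _ "vector [z$1, 0]"] conjI seg) (auto simp: mem_unit_square unit_hole_def)
  qed
  then obtain w where w: "\<And>z. z \<in> ?X \<Longrightarrow> closed_segment z (w z) \<subseteq> ?X \<and> closed_segment (w z) 0 \<subseteq> ?X"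
    by metis
  have "connected (\<Union>z\<in>?X. closed_segment z (w z) \<union> closed_segment (w z) 0)"
  proof (rule connected_Union)
    have "0 \<in> S" if "S \<in> (\<lambda>z. closed_segment z (w z) \<union> closed_segment (w z) 0) ` ?X" for S
      using that by auto
    then show "\<Inter> ((\<lambda>z. closed_segment z (w z) \<union> closed_segment (w z) 0) ` ?X) \<noteq> {}" by blast
  next
    fix S assume "S \<in> (\<lambda>z. closed_segment z (w z) \<union> closed_segment (w z) 0) ` ?X"
    then obtain z where "S = closed_segment z (w z) \<union> closed_segment (w z) 0" by blast
    moreover have "w z \<in> closed_segment z (w z) \<inter> closed_segment (w z) 0" by simp
    ultimately show "connected S" using connected_Un[OF connected_segment connected_segment] by blast
  qed
  moreover have "(\<Union>z\<in>?X. closed_segment z (w z) \<union> closed_segment (w z) 0) = ?X"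
    using w ends_in_segment(1) by fast
  ultimately show ?thesis by simp
qed

text \<open>The Cantor part of the hole is an intersection of decreasing compact strips, so a
  compact \<open>M\<close> that avoids the hole avoids one of the strips, and
  \<open>cantor_poincare\<close> applies on the middle subsquare whatever the level.
  \<open>subsquare_average\<close> passes to the full square. Under scaling,
  \<open>r\<^sup>2\<close> from the integral against \<open>r\<close> from the energy leaves the
  factor \<open>r\<close>.\<close>

lemma hole_poincare:
  assumes "p > 0"
  obtains A where "A > 0"
    "\<And>v M d r. v \<in> borel_measurable borel \<Longrightarrow> compact M \<Longrightarrow> (\<And>z. v z \<noteq> 0 \<Longrightarrow> z \<in> M) \<Longrightarrow> r > 0
      \<Longrightarrow> M \<inter> affine_map d r ` unit_hole = {}
      \<Longrightarrow> power_integral p (affine_map d r ` box 0 1) v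
        \<le> ennreal (A * r) * energy p (affine_map d r ` box 0 1) v"
proof -
  obtain A where A: "A > 0" and
    cantor: "\<And>k v. v \<in> borel_measurable borel \<Longrightarrow> (\<And>z. z \<in> cantor_strip k \<Longrightarrow> v z = 0)
       \<Longrightarrow> power_integral p (box 0 1) v \<le> ennreal A * energy p (box 0 1) v"
    using cantor_poincare[OF assms] by blast
  obtain c where c: "c > 0" and
    split: "\<And>a b :: real. \<bar>a\<bar> powr p \<le> 3/2 * \<bar>b\<bar> powr p + c * \<bar>a - b\<bar> powr p"
    using powr_split[OF assms] by blast
  \<comment> \<open>Nine times \<open>A / 2 + 8 * c\<close>, since the middle subsquare has area
    \<open>1/9\<close>.\<close>
  define B where "B = 9/2 * A + 72 * c"
  have B: "B > 0" using A c by (simp add: B_def)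
  let ?U = "box 0 (1::real^2)"
  let ?\<psi> = "affine_map (vector [1/3, 1/3]) (1/3)"
  have unit: "power_integral p ?U v \<le> ennreal B * energy p ?U v"
    if [measurable]: "v \<in> borel_measurable borel" and M: "compact M" "\<And>z. v z \<noteq> 0 \<Longrightarrow> z \<in> M" "M \<inter> unit_hole = {}"
    for v M
  proof -
    obtain k where k: "M \<inter> ?\<psi> ` cantor_strip k = {}"
    proof (rule ccontr)
      assume "\<not> thesis"
      then have ne: "M \<inter> ?\<psi> ` cantor_strip k \<noteq> {}" for k using that by blast
      have "compact (cantor_strip k)" for k
      proof -
        have "closed (cantor_strip k)" unfolding cantor_strip_def
          by (intro closed_product compact_imp_closed compact_cantor_level) auto
        moreover have "cbox 0 1 \<inter> cantor_strip k = cantor_strip k"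
          using cantor_level_subset[of k] by (auto simp: cantor_strip_def mem_unit_square)
        ultimately show ?thesis by (metis compact_Int_closed compact_cbox)
      qed
      then have comp: "compact (M \<inter> ?\<psi> ` cantor_strip k)" for k
        using M(1) by (intro compact_Int compact_continuous_image continuous_intros) auto
      have "antimono cantor_strip"
        using cantor_level_Suc_subset by (intro decseq_SucI) (auto simp: cantor_strip_def)
      then have mono: "M \<inter> ?\<psi> ` cantor_strip n \<subseteq> M \<inter> ?\<psi> ` cantor_strip m" if "m \<le> n" for m n
        using that by (auto dest: antimonoD)
      have "(\<Inter>k. M \<inter> ?\<psi> ` cantor_strip k) \<noteq> {}"
        by (rule compact_nest[OF comp ne mono])
      then obtain x where "x \<in> (\<Inter>k. M \<inter> ?\<psi> ` cantor_strip k)" by (metis ex_in_conv)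
      then have x: "x \<in> M" "\<And>k. x \<in> ?\<psi> ` cantor_strip k" by (simp_all only: INT_iff Int_iff UNIV_I simp_thms)
      define w :: "real^2" where "w = 3 *\<^sub>R x - vector [1, 1]"
      have "w \<in> cantor_strip k" for k
      proof -
        obtain z where z: "z \<in> cantor_strip k" "x = ?\<psi> z" using x(2)[of k] by blast
        then have "w = z" by (simp add: w_def vec_eq_iff forall_2)
        then show ?thesis using z by simp
      qed
      then have "w$1 \<in> cantor_set" "w$2 \<in> {0..1}" unfolding cantor_set_def cantor_strip_def by auto
      moreover have "x$1 = (w$1 + 1) / 3" "x$2 = (w$2 + 1) / 3" by (auto simp: w_def)
      ultimately have "x \<in> unit_hole" by (auto simp: unit_hole_def hole_columns_def)
      then show False using x(1) M(3) by blast
    qed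
    have sub: "?\<psi> ` ?U \<subseteq> ?U" by (auto simp: mem_unit_square)
    have "ennreal ((1/3)\<^sup>2) * power_integral p ?U v
        \<le> ennreal (3/2 * (1/3)\<^sup>2) * power_integral p ?U (v \<circ> ?\<psi>) + ennreal (8 * c) * energy p ?U v"
      using sub c assms by (intro subsquare_average split) auto
    also have "power_integral p ?U (v \<circ> ?\<psi>) \<le> ennreal A * energy p ?U (v \<circ> ?\<psi>)"
      by (rule cantor[of _ k]) (use k M(2) in auto)
    also have "ennreal (3/2 * (1/3)\<^sup>2) * (ennreal A * energy p ?U (v \<circ> ?\<psi>)) = ennreal (A/2) * energy p (?\<psi> ` ?U) v"
      using A cross_energy_affine[of v ?U ?U "1/3" p "vector [1/3, 1/3]"]
      by (simp add: mult.assoc[symmetric] power2_eq_square flip: ennreal_mult)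
    also have "energy p (?\<psi> ` ?U) v \<le> energy p ?U v"
      using sub by (intro cross_energy_mono)
    also have "ennreal (A/2) * energy p ?U v + ennreal (8 * c) * energy p ?U v = ennreal (B/9) * energy p ?U v"
      using A c by (simp add: B_def add_divide_distrib flip: distrib_right ennreal_plus)
    finally have "ennreal 9 * (ennreal ((1/3)\<^sup>2) * power_integral p ?U v) \<le> ennreal 9 * (ennreal (B/9) * energy p ?U v)"
      by (auto intro: mult_left_mono simp: add_right_mono mult_left_mono)
    then show ?thesis
      using B by (simp add: mult.assoc[symmetric] power2_eq_square flip: ennreal_mult ennreal_numeral)
  qed
  have "power_integral p (affine_map d r ` ?U) v \<le> ennreal (B * r) * energy p (affine_map d r ` ?U) v"
    if [measurable]: "v \<in> borel_measurable borel" and M: "compact M" "\<And>z. v z \<noteq> 0 \<Longrightarrow> z \<in> M" and r: "r > 0"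
      and "M \<inter> affine_map d r ` unit_hole = {}" for v M d r
  proof -
    let ?M = "affine_map (- (1/r) *\<^sub>R d) (1/r) ` M"
    have inv: "affine_map (- (1/r) *\<^sub>R d) (1/r) (affine_map d r x) = x"
      "affine_map d r (affine_map (- (1/r) *\<^sub>R d) (1/r) x) = x" for x
      using r by (auto simp: algebra_simps)
    have "power_integral p (affine_map d r ` ?U) v = ennreal (r\<^sup>2) * power_integral p ?U (v \<circ> affine_map d r)"
      using r by (subst set_nn_integral_affine) auto
    also have "\<dots> \<le> ennreal (r\<^sup>2) * (ennreal B * energy p ?U (v \<circ> affine_map d r))"
    proof (intro mult_left_mono unit[of _ ?M])
      show "compact ?M" using M(1) by (intro compact_continuous_image continuous_intros)
      show "z \<in> ?M" if "(v \<circ> affine_map d r) z \<noteq> 0" for z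
        using M(2)[of "affine_map d r z"] that inv(1)[of z] by force
      have False if "x \<in> M" "affine_map (- (1/r) *\<^sub>R d) (1/r) x \<in> unit_hole" for x
        using that inv(2)[of x] \<open>M \<inter> affine_map d r ` unit_hole = {}\<close> by (metis disjoint_iff imageI)
      then show "?M \<inter> unit_hole = {}" by auto
    qed auto
    also have "\<dots> = ennreal (B * r) * (ennreal r * energy p ?U (v \<circ> affine_map d r))"
      using B r by (simp add: mult.assoc[symmetric] flip: ennreal_mult)
        (simp add: power2_eq_square mult.commute mult.left_commute)
    also have "ennreal r * energy p ?U (v \<circ> affine_map d r) = energy p (affine_map d r ` ?U) v"
      using r by (intro cross_energy_affine[symmetric]) auto
    finally show ?thesis .
  qed
  then show ?thesis using B that by blast
qed

section \<open>Test functions and capacity of squares\<close>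

lemma mem_affine_square:
  assumes "r > 0"
  shows "z \<in> affine_map d r ` box 0 1 \<longleftrightarrow> d$1 < z$1 \<and> z$1 < d$1 + r \<and> d$2 < z$2 \<and> z$2 < d$2 + r"
    and "z \<in> affine_map d r ` cbox 0 1 \<longleftrightarrow> d$1 \<le> z$1 \<and> z$1 \<le> d$1 + r \<and> d$2 \<le> z$2 \<and> z$2 \<le> d$2 + r"
proof -
  have *: "z \<in> affine_map d r ` S \<longleftrightarrow> (1/r) *\<^sub>R (z - d) \<in> S" for S
    using assms by (force simp: image_iff)
  show "z \<in> affine_map d r ` box 0 1 \<longleftrightarrow> d$1 < z$1 \<and> z$1 < d$1 + r \<and> d$2 < z$2 \<and> z$2 < d$2 + r"
    "z \<in> affine_map d r ` cbox 0 1 \<longleftrightarrow> d$1 \<le> z$1 \<and> z$1 \<le> d$1 + r \<and> d$2 \<le> z$2 \<and> z$2 \<le> d$2 + r"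
    unfolding * mem_unit_square using assms by (auto simp: field_simps)
qed

text \<open>Passing from \<open>\<phi>\<close> to \<open>u\<close> affects only pairs with a point
  in \<open>D\<close>. For these the kernel of \<open>u\<close> is dominated by the truncated
  kernel, whose integral in one variable is at most \<open>C * L\<close>; the factor 2 counts which
  of the two points lies in \<open>D\<close>.\<close>

lemma energy_modification_le:
  fixes u \<phi> :: "real^2 \<Rightarrow> real"
  assumes kernel: "\<And>L (x::real^2). L > 0 \<Longrightarrow> (\<integral>\<^sup>+y. ennreal (min 1 (L * dist x y) powr p / dist x y powr 3) \<partial>lborel) \<le> ennreal (C * L)"
    and "p > 0" "C > 0" "L > 0" and [measurable]: "u \<in> borel_measurable borel" "\<phi> \<in> borel_measurable borel" "D \<in> sets borel"
    and lip: "\<And>x y. \<bar>u x - u y\<bar> \<le> L * dist x y" and range: "\<And>x. 0 \<le> u x" "\<And>x. u x \<le> 1"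
    and eq: "\<And>x. x \<notin> D \<Longrightarrow> u x = \<phi> x"
  shows "energy p UNIV u \<le> energy p UNIV \<phi> + ennreal (2 * C * L) * emeasure lborel D"
proof -
  define K where "K = (\<lambda>x y :: real^2. ennreal (min 1 (L * dist x y) powr p / dist x y powr 3))"
  have [measurable]: "(\<lambda>x. K (f x) (g x)) \<in> borel_measurable M" 
    if [measurable]: "f \<in> borel_measurable M" "g \<in> borel_measurable M" for M and f g :: "'b \<Rightarrow> real^2"
    unfolding K_def by measurable
  have K: "gag_kernel p u x y \<le> K x y" for x y
  proof -
    have "\<bar>u x - u y\<bar> \<le> min 1 (L * dist x y)"
      using lip[of x y] range[of x] range[of y] by auto
    then show ?thesis
      unfolding K_def gag_kernel_def using \<open>p > 0\<close>
      by (intro ennreal_leI divide_right_mono powr_mono2) auto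
  qed
  have pt: "gag_kernel p u x y \<le> gag_kernel p \<phi> x y + (K x y * indicator D x + K x y * indicator D y)" for x y
  proof (cases "x \<in> D \<or> y \<in> D")
    case True
    then show ?thesis using K[of x y] 
      by (auto simp: indicator_def intro!: add_increasing intro: order_trans add_increasing2)
  next
    case False
    then show ?thesis using eq[of x] eq[of y] by (simp add: gag_kernel_def)
  qed
  have int: "(\<integral>\<^sup>+x. (\<integral>\<^sup>+y. K x y \<partial>lborel) * indicator D x \<partial>lborel) \<le> ennreal (C * L) * emeasure lborel D"
  proof -
    have "(\<integral>\<^sup>+x. (\<integral>\<^sup>+y. K x y \<partial>lborel) * indicator D x \<partial>lborel) \<le> (\<integral>\<^sup>+x. ennreal (C * L) * indicator D x \<partial>lborel)"
      unfolding K_def using \<open>L > 0\<close> by (intro nn_integral_mono mult_right_mono kernel) auto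
    then show ?thesis by (simp add: nn_integral_cmult_indicator)
  qed
  have "energy p UNIV u \<le> (\<integral>\<^sup>+x. (\<integral>\<^sup>+y. (gag_kernel p \<phi> x y + (K x y * indicator D x + K x y * indicator D y)) \<partial>lborel) \<partial>lborel)"
    unfolding cross_energy_def using pt by (auto intro!: nn_integral_mono)
  also have "\<dots> = energy p UNIV \<phi> + ((\<integral>\<^sup>+x. (\<integral>\<^sup>+y. K x y \<partial>lborel) * indicator D x \<partial>lborel)
      + (\<integral>\<^sup>+x. (\<integral>\<^sup>+y. K x y * indicator D y \<partial>lborel) \<partial>lborel))"
    unfolding cross_energy_def by (simp add: nn_integral_add nn_integral_multc)
  also have "(\<integral>\<^sup>+x. (\<integral>\<^sup>+y. K x y * indicator D y \<partial>lborel) \<partial>lborel)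
      = (\<integral>\<^sup>+y. (\<integral>\<^sup>+x. K x y * indicator D y \<partial>lborel) \<partial>lborel)"
    by (rule lborel_pair.Fubini'[symmetric]) simp
  also have "\<dots> = (\<integral>\<^sup>+x. (\<integral>\<^sup>+y. K x y \<partial>lborel) * indicator D x \<partial>lborel)"
    by (simp add: nn_integral_multc K_def dist_commute)
  also have "energy p UNIV \<phi> + (\<dots> + \<dots>) \<le> energy p UNIV \<phi> + (ennreal (C * L) * emeasure lborel D + ennreal (C * L) * emeasure lborel D)"
    by (intro add_left_mono add_mono int)
  also have "\<dots> = energy p UNIV \<phi> + ennreal (2 * C * L) * emeasure lborel D"
    using \<open>C > 0\<close> \<open>L > 0\<close> by (simp flip: distrib_right ennreal_plus)
  finally show ?thesis .
qed

definition clamp01 :: "real \<Rightarrow> real" where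
  "clamp01 t = max 0 (min 1 t)"

lemma clamp01_lipschitz: "\<bar>clamp01 s - clamp01 t\<bar> \<le> \<bar>s - t\<bar>"
  by (auto simp: clamp01_def)

lemma clamp01_range: "0 \<le> clamp01 t" "clamp01 t \<le> 1"
  by (auto simp: clamp01_def)

text \<open>Since \<open>s p = 1\<close>, the energy of a cutoff at distance \<open>\<rho>\<close> from a segment is scale invariant,
  hence bounded as \<open>\<rho> \<rightarrow> 0\<close>.\<close>

lemma segment_cutoff:
  fixes c :: "real^2"
  assumes "p > 1" "\<delta> > 0"
  obtains C where "\<And>\<rho>. 0 < \<rho> \<Longrightarrow> \<rho> \<le> \<delta> \<Longrightarrow> \<exists>u. continuous_on UNIV u
    \<and> (\<forall>z. u z \<noteq> 0 \<longrightarrow> \<rho>/2 \<le> \<bar>z$1 - c$1\<bar> \<and> \<bar>z$1 - c$1\<bar> \<le> \<delta>/2 \<and> \<bar>z$2 - c$2\<bar> \<le> \<delta>/2)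
    \<and> (\<forall>z. \<rho> \<le> \<bar>z$1 - c$1\<bar> \<and> \<bar>z$1 - c$1\<bar> \<le> \<delta>/4 \<and> \<bar>z$2 - c$2\<bar> \<le> \<delta>/4 \<longrightarrow> u z = 1)
    \<and> energy p UNIV u \<le> ennreal C"
proof -
  obtain C where "C > 0" and kernel: "\<And>L (x::real^2). L > 0 \<Longrightarrow>
    (\<integral>\<^sup>+y. ennreal (min 1 (L * dist x y) powr p / dist x y powr 3) \<partial>lborel) \<le> ennreal (C * L)"
    using kernel_integral_bound[OF assms(1)] by blast
  note modify = energy_modification_le[OF kernel order.strict_trans[OF zero_less_one assms(1)] \<open>C > 0\<close>]
  define m where "m z = max \<bar>z$1 - c$1\<bar> \<bar>z$2 - c$2\<bar>" for z :: "real^2"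
  have m_le: "m z \<le> t \<longleftrightarrow> c$1 - t \<le> z$1 \<and> z$1 \<le> c$1 + t \<and> c$2 - t \<le> z$2 \<and> z$2 \<le> c$2 + t" for z t
    unfolding m_def by auto
  \<comment> \<open>A plateau: 1 up to distance \<open>\<delta>/4\<close> from \<open>c\<close> in
    the maximum norm, 0 beyond \<open>\<delta>/2\<close>. The factor \<open>\<eta>\<close>
    introduced below cuts out a strip around the vertical line through \<open>c\<close>.\<close>
  define \<phi> where "\<phi> z = clamp01 (2 - 4 / \<delta> * m z)" for z
  have \<phi>_lip: "\<bar>\<phi> x - \<phi> y\<bar> \<le> 4 / \<delta> * dist x y" for x y
  proof -
    have "\<bar>m x - m y\<bar> \<le> dist x y"
      using dist_vec2_ge[of x 1 y] dist_vec2_ge[of x 2 y] unfolding m_def by linarith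
    then have "4 / \<delta> * \<bar>m x - m y\<bar> \<le> 4 / \<delta> * dist x y"
      using assms by (intro mult_left_mono) auto
    moreover have "(2 - 4 / \<delta> * m x) - (2 - 4 / \<delta> * m y) = 4 / \<delta> * (m y - m x)"
      by (simp add: algebra_simps diff_divide_distrib)
    then have "\<bar>(2 - 4 / \<delta> * m x) - (2 - 4 / \<delta> * m y)\<bar> = 4 / \<delta> * \<bar>m x - m y\<bar>"
      using assms by (simp only: abs_mult) (simp add: abs_minus_commute)
    ultimately show ?thesis
      unfolding \<phi>_def using clamp01_lipschitz[of "2 - 4 / \<delta> * m x" "2 - 4 / \<delta> * m y"] by linarith
  qed
  have \<phi>_range: "0 \<le> \<phi> z" "\<phi> z \<le> 1" for z by (auto simp: \<phi>_def clamp01_range)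
  have \<phi>_zero: "\<phi> z = 0" if "m z > \<delta>/2" for z
    using that assms by (auto simp: \<phi>_def clamp01_def field_simps)
  have \<phi>_one: "\<phi> z = 1" if "m z \<le> \<delta>/4" for z
    using that assms by (auto simp: \<phi>_def clamp01_def field_simps)
  have \<phi>_cont: "continuous_on UNIV \<phi>"
    unfolding \<phi>_def m_def clamp01_def by (intro continuous_intros)
  then have [measurable]: "\<phi> \<in> borel_measurable borel" by (rule borel_measurable_continuous_onI)
  define B where "B = cbox (vector [c$1 - \<delta>/2, c$2 - \<delta>/2] :: real^2) (vector [c$1 + \<delta>/2, c$2 + \<delta>/2])"
  have "energy p UNIV \<phi> \<le> energy p UNIV (\<lambda>_. 0) + ennreal (2 * C * (4/\<delta>)) * emeasure lborel B"
  proof (intro modify \<phi>_lip \<phi>_range \<phi>_zero)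
    show "\<delta>/2 < m z" if "z \<notin> B" for z
      using that m_le[of z "\<delta>/2"] by (auto simp: B_def mem_box_cart forall_2 simp flip: not_le)
  qed (use assms in \<open>auto simp: B_def\<close>)
  also have "energy p UNIV (\<lambda>_. 0) = 0"
    using assms by (simp add: cross_energy_def gag_kernel_def)
  also have "emeasure lborel B = ennreal (\<delta> * \<delta>)"
    unfolding B_def using assms by (subst emeasure_rectangle) auto
  also have "0 + ennreal (2 * C * (4/\<delta>)) * ennreal (\<delta> * \<delta>) = ennreal (8 * C * \<delta>)"
    using assms \<open>C > 0\<close> by (simp flip: ennreal_mult)
  finally have \<phi>_energy: "energy p UNIV \<phi> \<le> ennreal (8 * C * \<delta>)" .
  show ?thesis
  proof (rule that)
    fix \<rho> :: real assume \<rho>: "0 < \<rho>" "\<rho> \<le> \<delta>"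
    define \<eta> where "\<eta> z = clamp01 (2 / \<rho> * \<bar>z$1 - c$1\<bar> - 1)" for z :: "real^2"
    define u where "u z = \<phi> z * \<eta> z" for z
    have \<eta>_range: "0 \<le> \<eta> z" "\<eta> z \<le> 1" for z by (auto simp: \<eta>_def clamp01_range)
    have \<eta>_lip: "\<bar>\<eta> x - \<eta> y\<bar> \<le> 2 / \<rho> * dist x y" for x y
    proof -
      have "2 / \<rho> * \<bar>\<bar>x$1 - c$1\<bar> - \<bar>y$1 - c$1\<bar>\<bar> \<le> 2 / \<rho> * dist x y"
        using \<rho> dist_vec2_ge[of x 1 y] by (intro mult_left_mono) auto
      moreover have "(2 / \<rho> * \<bar>x$1 - c$1\<bar> - 1) - (2 / \<rho> * \<bar>y$1 - c$1\<bar> - 1)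
          = 2 / \<rho> * (\<bar>x$1 - c$1\<bar> - \<bar>y$1 - c$1\<bar>)"
        by (simp add: algebra_simps diff_divide_distrib)
      then have "\<bar>(2 / \<rho> * \<bar>x$1 - c$1\<bar> - 1) - (2 / \<rho> * \<bar>y$1 - c$1\<bar> - 1)\<bar>
          = 2 / \<rho> * \<bar>\<bar>x$1 - c$1\<bar> - \<bar>y$1 - c$1\<bar>\<bar>"
        using \<rho> by (simp only: abs_mult) simp
      ultimately show ?thesis
        unfolding \<eta>_def using clamp01_lipschitz[of "2 / \<rho> * \<bar>x$1 - c$1\<bar> - 1" "2 / \<rho> * \<bar>y$1 - c$1\<bar> - 1"]
        by linarith
    qed
    have \<eta>_zero: "\<eta> z = 0" if "\<bar>z$1 - c$1\<bar> < \<rho>/2" for z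
      using that \<rho> by (auto simp: \<eta>_def clamp01_def field_simps)
    have \<eta>_one: "\<eta> z = 1" if "\<bar>z$1 - c$1\<bar> \<ge> \<rho>" for z
      using that \<rho> by (auto simp: \<eta>_def clamp01_def field_simps)
    have u_lip: "\<bar>u x - u y\<bar> \<le> 6 / \<rho> * dist x y" for x y
    proof -
      have "u x - u y = \<phi> x * (\<eta> x - \<eta> y) + (\<phi> x - \<phi> y) * \<eta> y"
        by (simp add: u_def algebra_simps)
      then have "\<bar>u x - u y\<bar> \<le> \<bar>\<phi> x\<bar> * \<bar>\<eta> x - \<eta> y\<bar> + \<bar>\<phi> x - \<phi> y\<bar> * \<bar>\<eta> y\<bar>"
        using abs_triangle_ineq by (simp flip: abs_mult)
      also have "\<dots> \<le> 1 * \<bar>\<eta> x - \<eta> y\<bar> + \<bar>\<phi> x - \<phi> y\<bar> * 1"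
        using \<phi>_range[of x] \<eta>_range[of y] by (intro add_mono mult_mono) auto
      also have "\<dots> \<le> 2 / \<rho> * dist x y + 4 / \<delta> * dist x y"
        using \<eta>_lip[of x y] \<phi>_lip[of x y] by simp
      also have "4 / \<delta> * dist x y \<le> 4 / \<rho> * dist x y"
        using \<rho> assms by (intro mult_right_mono divide_left_mono) auto
      finally show ?thesis by (simp add: add_divide_distrib[symmetric] distrib_right[symmetric])
    qed
    have u_cont: "continuous_on UNIV u"
      unfolding u_def \<eta>_def clamp01_def by (intro continuous_intros \<phi>_cont)
    then have [measurable]: "u \<in> borel_measurable borel" by (rule borel_measurable_continuous_onI)
    \<comment> \<open>Outside this rectangle \<open>u = \<phi>\<close>, because there
      \<open>\<eta> = 1\<close> or \<open>\<phi> = 0\<close>. The area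
      \<open>2 * \<rho> * \<delta>\<close> cancels the denominator of the Lipschitz constant
      \<open>6 / \<rho>\<close>, so the added cost \<open>24 * C * \<delta>\<close> is free of
      \<open>\<rho>\<close>.\<close>
    define D where "D = cbox (vector [c$1 - \<rho>, c$2 - \<delta>/2] :: real^2) (vector [c$1 + \<rho>, c$2 + \<delta>/2])"
    have "energy p UNIV u \<le> energy p UNIV \<phi> + ennreal (2 * C * (6/\<rho>)) * emeasure lborel D"
    proof (intro modify u_lip)
      show "u z = \<phi> z" if "z \<notin> D" for z
      proof (cases "\<bar>z$1 - c$1\<bar> \<ge> \<rho>")
        case False
        then have "m z > \<delta>/2"
          using that m_le[of z "\<delta>/2"]
          by (auto simp: D_def mem_box_cart forall_2 simp flip: not_le)
        then show ?thesis by (simp add: u_def \<phi>_zero)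
      qed (simp add: u_def \<eta>_one)
      show "0 \<le> u z" "u z \<le> 1" for z
        using \<phi>_range[of z] \<eta>_range[of z] by (auto simp: u_def mult_le_one)
    qed (use \<rho> in \<open>auto simp: D_def\<close>)
    also have "emeasure lborel D = ennreal (2 * \<rho> * \<delta>)"
      unfolding D_def using assms \<rho> by (subst emeasure_rectangle) auto
    also have "energy p UNIV \<phi> + ennreal (2 * C * (6/\<rho>)) * ennreal (2 * \<rho> * \<delta>)
      \<le> ennreal (8 * C * \<delta>) + ennreal (2 * C * (6/\<rho>)) * ennreal (2 * \<rho> * \<delta>)"
      by (intro add_right_mono \<phi>_energy)
    also have "\<dots> = ennreal (32 * C * \<delta>)"
      using assms \<rho> \<open>C > 0\<close> by (simp flip: ennreal_mult ennreal_plus)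
    finally have "energy p UNIV u \<le> ennreal (32 * C * \<delta>)" .
    moreover have "\<rho>/2 \<le> \<bar>z$1 - c$1\<bar> \<and> \<bar>z$1 - c$1\<bar> \<le> \<delta>/2 \<and> \<bar>z$2 - c$2\<bar> \<le> \<delta>/2" if "u z \<noteq> 0" for z
    proof -
      have "\<not> m z > \<delta>/2" "\<not> \<bar>z$1 - c$1\<bar> < \<rho>/2"
        using that \<phi>_zero[of z] \<eta>_zero[of z] by (auto simp: u_def)
      then show ?thesis by (simp only: m_def not_less max.bounded_iff)
    qed
    moreover have "u z = 1"
      if "\<rho> \<le> \<bar>z$1 - c$1\<bar> \<and> \<bar>z$1 - c$1\<bar> \<le> \<delta>/4 \<and> \<bar>z$2 - c$2\<bar> \<le> \<delta>/4" for z
      using that \<phi>_one[of z] \<eta>_one[of z] by (auto simp: u_def m_def)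
    ultimately show "\<exists>u. continuous_on UNIV u
      \<and> (\<forall>z. u z \<noteq> 0 \<longrightarrow> \<rho>/2 \<le> \<bar>z$1 - c$1\<bar> \<and> \<bar>z$1 - c$1\<bar> \<le> \<delta>/2 \<and> \<bar>z$2 - c$2\<bar> \<le> \<delta>/2)
      \<and> (\<forall>z. \<rho> \<le> \<bar>z$1 - c$1\<bar> \<and> \<bar>z$1 - c$1\<bar> \<le> \<delta>/4 \<and> \<bar>z$2 - c$2\<bar> \<le> \<delta>/4 \<longrightarrow> u z = 1)
      \<and> energy p UNIV u \<le> ennreal (32 * C * \<delta>)"
      using u_cont by blast
  qed
qed

text \<open>The square is doubled again and again. Each step puts the factor
  \<open>3/2 * 1/4\<close> on the integral over the doubled square, while the energy cost doubles
  with the side, so the costs form a geometric series of ratio \<open>3/4\<close>. Finiteness of the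
  integral over the plane removes the remainder and excludes nonzero constants. For
  \<open>v \<ge> 1\<close> on the square, the energy is therefore at least
  \<open>r / C\<close>.\<close>

lemma square_integral_le_energy:
  assumes "p > 0"
  obtains C where "C > 0"
    "\<And>v d r. v \<in> borel_measurable borel \<Longrightarrow> power_integral p UNIV v < \<infinity> \<Longrightarrow> r > 0
      \<Longrightarrow> power_integral p (affine_map d r ` box 0 1) v \<le> ennreal (C * r) * energy p UNIV v"
proof -
  obtain c where c: "c > 0" and
    split: "\<And>a b :: real. \<bar>a\<bar> powr p \<le> 3/2 * \<bar>b\<bar> powr p + c * \<bar>a - b\<bar> powr p"
    using powr_split[OF assms] by blast
  \<comment> \<open>The solution of \<open>K = 3/8 * (2 * K) + 16 * c\<close>. Here 16 is
    \<open>4^3 / 4\<close>, from the distance bound \<open>4 * r\<close> and the area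
    \<open>4 * r\<^sup>2\<close> of the doubled square.\<close>
  define K where "K = 64 * c"
  have K: "K > 0" using c by (simp add: K_def)
  have main: "power_integral p (affine_map d r ` box 0 1) v \<le> ennreal (K * r) * energy p UNIV v"
    if [measurable]: "v \<in> borel_measurable borel" and fin: "power_integral p UNIV v < \<infinity>" and "r > 0" for v d r
  proof -
    define P where "P r = power_integral p (affine_map d r ` box 0 1) v" for r
    define E where "E = energy p UNIV v"
    have step: "P r \<le> ennreal (3/8) * P (2 * r) + ennreal (16 * c * r) * E" if "r > 0" for r
    proof -
      let ?P = "affine_map d r ` box 0 1" and ?R = "affine_map d (2 * r) ` box 0 1"
      have [measurable]: "?P \<in> sets borel" "?R \<in> sets borel"
        using that by (auto intro!: affine_image_measurable)
      have "emeasure lborel ?R * P r \<le> ennreal (3/2) * emeasure lborel ?P * P (2 * r)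
          + ennreal (c * (4 * r)^3) * cross_energy p ?P ?R v"
        unfolding P_def
      proof (intro split_average[OF split assms c])
        fix x y assume "x \<in> ?P" "y \<in> ?R"
        then show "dist x y \<le> 4 * r"
          using that dist_vec2_le[of x y] by (auto simp: mem_affine_square simp del: image_iff)
      qed auto
      also have "\<dots> \<le> ennreal (3/2) * emeasure lborel ?P * P (2 * r) + ennreal (c * (4 * r)^3) * E"
        unfolding E_def by (intro add_left_mono mult_left_mono cross_energy_mono) auto
      also have "emeasure lborel ?P = ennreal (r\<^sup>2)"
        using that by (subst emeasure_affine_image) (auto simp: emeasure_unit_square)
      also have "emeasure lborel ?R = ennreal (4 * r\<^sup>2)"
        using that by (subst emeasure_affine_image) (auto simp: emeasure_unit_square)
      finally have "ennreal (4 * r\<^sup>2) * P r \<le> ennreal (3/2) * ennreal (r\<^sup>2) * P (2 * r) + ennreal (c * (4 * r)^3) * E" .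
      then have "ennreal (1 / (4 * r\<^sup>2)) * (ennreal (4 * r\<^sup>2) * P r)
        \<le> ennreal (1 / (4 * r\<^sup>2)) * (ennreal (3/2) * ennreal (r\<^sup>2) * P (2 * r) + ennreal (c * (4 * r)^3) * E)"
        by (rule mult_left_mono) simp
      then show ?thesis
        using that c
        by (simp add: distrib_left mult.assoc[symmetric] power2_eq_square power3_eq_cube flip: ennreal_mult)
    qed
    have iter: "P r \<le> ennreal ((3/8)^m) * power_integral p UNIV v + ennreal (K * r) * E" if "r > 0" for m r
      using that
    proof (induction m arbitrary: r)
      case 0
      have "P r \<le> power_integral p UNIV v"
        unfolding P_def by (intro nn_integral_mono) (auto simp: indicator_def)
      then show ?case by (simp add: add_increasing2)
    next
      case (Suc m)
      have "P r \<le> ennreal (3/8) * P (2 * r) + ennreal (16 * c * r) * E"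
        by (rule step[OF Suc.prems])
      also have "\<dots> \<le> ennreal (3/8) * (ennreal ((3/8)^m) * power_integral p UNIV v + ennreal (K * (2 * r)) * E)
          + ennreal (16 * c * r) * E"
        using Suc.prems by (intro add_right_mono mult_left_mono Suc.IH) auto
      also have "\<dots> = ennreal ((3/8)^Suc m) * power_integral p UNIV v 
          + (ennreal (3/8 * (K * (2 * r))) * E + ennreal (16 * c * r) * E)"
        using Suc.prems K by (simp add: distrib_left mult.assoc[symmetric] add.assoc flip: ennreal_mult)
      also have "ennreal (3/8 * (K * (2 * r))) * E + ennreal (16 * c * r) * E = ennreal (K * r) * E"
        using Suc.prems c by (simp add: K_def mult.assoc flip: distrib_right ennreal_plus)
      finally show ?case .
    qed
    have "(\<lambda>m. ennreal ((3/8)^m) * power_integral p UNIV v + ennreal (K * r) * E)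
        \<longlonglongrightarrow> ennreal 0 * power_integral p UNIV v + ennreal (K * r) * E"
      using fin by (intro tendsto_add tendsto_const tendsto_mult_ennreal tendsto_ennrealI LIMSEQ_power_zero) auto
    then have "P r \<le> ennreal 0 * power_integral p UNIV v + ennreal (K * r) * E"
      using iter \<open>r > 0\<close> by (intro LIMSEQ_le_const) auto
    then show ?thesis unfolding P_def E_def by simp
  qed
  show ?thesis by (rule that[OF K main])
qed

section \<open>The perforated domain\<close>

definition corner :: "(real^2) set \<Rightarrow> real^2" where
  "corner Q = interval_lowerbound Q"

definition side :: "(real^2) set \<Rightarrow> real" where
  "side Q = interval_upperbound Q $ 1 - interval_lowerbound Q $ 1"

lemma
  assumes "dyadic_cube Q"
  shows side_pos: "side Q > 0" 
    and dyadic_cube_eq: "Q = affine_map (corner Q) (side Q) ` cbox 0 1"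
    and interior_dyadic_cube: "interior Q = affine_map (corner Q) (side Q) ` box 0 1"
proof -
  obtain k :: int and m :: "int^2" where
    Q: "Q = cbox (\<chi> i. of_int (m $ i) * 2 powi k) (\<chi> i. (of_int (m $ i) + 1) * 2 powi k)"
    using assms unfolding dyadic_cube_def by blast
  define a b :: "real^2" where "a = (\<chi> i. of_int (m $ i) * 2 powi k)" and "b = (\<chi> i. (of_int (m $ i) + 1) * 2 powi k)"
  define r :: real where "r = 2 powi k"
  have r: "r > 0" by (simp add: r_def)
  have b: "b$i = a$i + r" for i by (simp add: a_def b_def r_def algebra_simps)
  have Q: "Q = cbox a b" unfolding Q a_def b_def ..
  have ne: "cbox a b \<noteq> {}" using r by (auto simp: interval_ne_empty_cart b)
  have corner: "corner Q = a" unfolding corner_def Q using ne by simp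
  have side: "side Q = r" unfolding side_def Q using ne by (simp add: b)
  show "side Q > 0" using side r by simp
  show "Q = affine_map (corner Q) (side Q) ` cbox 0 1"
    unfolding set_eq_iff corner side mem_affine_square[OF r] by (auto simp: Q mem_box_cart forall_2 b)
  show "interior Q = affine_map (corner Q) (side Q) ` box 0 1"
    unfolding set_eq_iff corner side mem_affine_square[OF r] by (auto simp: Q interior_cbox mem_box_cart forall_2 b)
qed

lemma mem_dyadic_cube:
  assumes "dyadic_cube Q"
  shows "z \<in> Q \<longleftrightarrow> (\<forall>i. corner Q $ i \<le> z$i \<and> z$i \<le> corner Q $ i + side Q)"
    and "z \<in> interior Q \<longleftrightarrow> (\<forall>i. corner Q $ i < z$i \<and> z$i < corner Q $ i + side Q)"
proof -
  show "z \<in> Q \<longleftrightarrow> (\<forall>i. corner Q $ i \<le> z$i \<and> z$i \<le> corner Q $ i + side Q)"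
    by (subst dyadic_cube_eq[OF assms]) (auto simp: mem_affine_square[OF side_pos[OF assms]] forall_2)
  show "z \<in> interior Q \<longleftrightarrow> (\<forall>i. corner Q $ i < z$i \<and> z$i < corner Q $ i + side Q)"
    by (subst interior_dyadic_cube[OF assms]) (auto simp: mem_affine_square[OF side_pos[OF assms]] forall_2)
qed

lemma compact_dyadic_cube: "dyadic_cube Q \<Longrightarrow> compact Q"
  unfolding dyadic_cube_def by auto

lemma corner_mem: "dyadic_cube Q \<Longrightarrow> corner Q \<in> Q"
  using side_pos[of Q] by (simp add: mem_dyadic_cube)

lemma closure_interior_dyadic_cube:
  fixes Q :: "(real^2) set"
  assumes Q: "dyadic_cube Q"
  shows "closure (interior Q) = Q"
proof -
  have "convex Q" using Q unfolding dyadic_cube_def by auto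
  moreover have "interior Q \<noteq> {}"
    unfolding interior_dyadic_cube[OF Q] by (simp add: interval_ne_empty_cart)
  ultimately show ?thesis
    using convex_closure_interior compact_imp_closed[OF compact_dyadic_cube[OF Q]] by (metis closure_closed)
qed

lemma diameter_dyadic_cube:
  assumes "dyadic_cube Q"
  shows "side Q \<le> diameter Q" "diameter Q \<le> 2 * side Q"
proof -
  have bdd: "bounded Q" using compact_dyadic_cube[OF assms] by (rule compact_imp_bounded)
  define w :: "real^2" where "w = corner Q + (\<chi> i. side Q)"
  have "w \<in> Q" using side_pos[OF assms] by (simp add: mem_dyadic_cube[OF assms] w_def)
  then have "dist w (corner Q) \<le> diameter Q"
    using diameter_bounded_bound[OF bdd] corner_mem[OF assms] by blast
  then show "side Q \<le> diameter Q"
    using dist_vec2_ge[of w 1 "corner Q"] by (simp add: w_def)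
  have "dist x y \<le> 2 * side Q" if "x \<in> Q" "y \<in> Q" for x y
  proof -
    have "\<bar>x$i - y$i\<bar> \<le> side Q" for i
      using that unfolding mem_dyadic_cube[OF assms] by (smt (verit))
    from this[of 1] this[of 2] show ?thesis using dist_vec2_le[of x y] by linarith
  qed
  then show "diameter Q \<le> 2 * side Q"
    using side_pos[OF assms] by (intro diameter_le) (auto simp: dist_norm)
qed

definition hole :: "(real^2) set \<Rightarrow> (real^2) set" where
  "hole Q = affine_map (corner Q) (side Q) ` unit_hole"

lemma hole_bounds:
  assumes "dyadic_cube Q" "z \<in> hole Q"
  shows "corner Q $ i + side Q / 6 \<le> z$i" "z$i \<le> corner Q $ i + 2/3 * side Q"
proof -
  obtain w where w: "w \<in> unit_hole" "z = affine_map (corner Q) (side Q) w"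
    using assms unfolding hole_def by blast
  have "side Q * (1/6) \<le> side Q * w$i" "side Q * w$i \<le> side Q * (2/3)"
    using unit_hole_bounds[OF w(1)] side_pos[OF assms(1)] by (auto intro!: mult_left_mono)
  then show "corner Q $ i + side Q / 6 \<le> z$i" "z$i \<le> corner Q $ i + 2/3 * side Q"
    using w by auto
qed

lemma hole_subset_interior:
  assumes "dyadic_cube Q"
  shows "hole Q \<subseteq> interior Q"
proof
  fix z assume "z \<in> hole Q"
  then have "corner Q $ i < z$i \<and> z$i < corner Q $ i + side Q" for i
    using hole_bounds[OF assms, of z i] side_pos[OF assms] by simp
  then show "z \<in> interior Q" by (simp add: mem_dyadic_cube[OF assms])
qed

lemma compact_hole: "compact (hole Q)"
  unfolding hole_def by (intro compact_continuous_image compact_unit_hole continuous_intros)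

lemma connected_cube_minus_hole:
  assumes "dyadic_cube Q"
  shows "connected (Q - hole Q)"
proof -
  have inj: "inj (affine_map (corner Q) (side Q))"
    using side_pos[OF assms] by (intro injI) simp
  have "affine_map (corner Q) (side Q) ` (cbox 0 1 - unit_hole) = Q - hole Q"
    by (simp only: image_set_diff[OF inj] dyadic_cube_eq[OF assms, symmetric] hole_def)
  then show ?thesis
    by (rule subst) (intro connected_continuous_image connected_square_minus_hole continuous_intros)
qed

text \<open>Used twice: for the disc, where it produces the perforated domain \<open>G\<close>, and
  later for \<open>G\<close> itself, where it supplies the basic facts on a Whitney decomposition of
  \<open>G\<close>.\<close>

locale holed_domain =
  fixes \<Omega> :: "(real^2) set" and \<W> :: "(real^2) set set" and C :: real
  assumes open_\<Omega>: "open \<Omega>" and connected_\<Omega>: "connected \<Omega>" and bounded_\<Omega>: "bounded \<Omega>"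
    and nonempty_\<Omega>: "\<Omega> \<noteq> {}"
    and whitney: "whitney_decomposition C \<Omega> \<W>"
begin

definition "G = \<Omega> - \<Union>(hole ` \<W>)"

lemmas whitney_conditions = whitney[unfolded whitney_decomposition_def, THEN conjunct1]
  whitney[unfolded whitney_decomposition_def, THEN conjunct2, THEN conjunct1]
  whitney[unfolded whitney_decomposition_def, THEN conjunct2, THEN conjunct2, THEN conjunct1]
  whitney[unfolded whitney_decomposition_def, THEN conjunct2, THEN conjunct2, THEN conjunct2, THEN conjunct1]

lemma dyadic: "Q \<in> \<W> \<Longrightarrow> dyadic_cube Q"
  and cover: "\<Union>\<W> = \<Omega>"
  and whitney_dist: "Q \<in> \<W> \<Longrightarrow> diameter Q \<le> setdist Q (frontier \<Omega>)"
    "Q \<in> \<W> \<Longrightarrow> setdist Q (frontier \<Omega>) \<le> 4 * diameter Q"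
  and interiors_disjoint: "Q \<in> \<W> \<Longrightarrow> R \<in> \<W> \<Longrightarrow> Q \<noteq> R \<Longrightarrow> interior Q \<inter> interior R = {}"
  using whitney_conditions unfolding pairwise_def by simp_all

text \<open>A cube is the closure of its interior, so a point of \<open>Q\<close> in the open set
  \<open>interior R\<close> would make the two interiors meet. Holes lie in interiors, hence no hole
  touches another cube.\<close>

lemma not_in_other_interior:
  assumes "Q \<in> \<W>" "R \<in> \<W>" "x \<in> Q" "x \<in> interior R"
  shows "R = Q"
proof (rule ccontr)
  assume "R \<noteq> Q"
  have "x \<in> closure (interior Q)" using closure_interior_dyadic_cube[OF dyadic[OF assms(1)]] assms(3) by simp
  then have "interior R \<inter> interior Q \<noteq> {}"
    using assms by (meson open_Int_closure_eq_empty open_interior disjoint_iff)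
  then show False using interiors_disjoint assms \<open>R \<noteq> Q\<close> by blast
qed

lemma cube_minus_hole_subset: "Q \<in> \<W> \<Longrightarrow> Q - hole Q \<subseteq> G"
  unfolding G_def using not_in_other_interior hole_subset_interior dyadic cover by blast

lemma frontier_nonempty: "frontier \<Omega> \<noteq> {}"
  using nonempty_\<Omega> bounded_\<Omega> not_bounded_UNIV by (auto simp: frontier_eq_empty)

lemma side_le_dist:
  assumes "Q \<in> \<W>" "x \<in> Q" "y \<notin> \<Omega>"
  shows "side Q \<le> dist x y"
proof -
  have "x \<in> \<Omega>" using assms cover by blast
  then have "closed_segment x y \<inter> frontier \<Omega> \<noteq> {}"
    using assms(3) by (intro connected_Int_frontier connected_segment) auto
  then obtain z where z: "z \<in> closed_segment x y" "z \<in> frontier \<Omega>" by blast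
  have "side Q \<le> diameter Q" by (rule diameter_dyadic_cube[OF dyadic[OF assms(1)]])
  also have "\<dots> \<le> setdist Q (frontier \<Omega>)" by (rule whitney_dist[OF assms(1)])
  also have "\<dots> \<le> dist x z" by (rule setdist_le_dist[OF assms(2) z(2)])
  also have "\<dots> \<le> dist x y" using dist_in_closed_segment[OF z(1)] by (simp add: dist_commute)
  finally show ?thesis .
qed

text \<open>An infinite union of compact holes need not be closed, so accumulation inside
  \<open>\<Omega>\<close> has to be ruled out. A hole of another cube \<open>R\<close> close to
  \<open>x\<close> forces \<open>R\<close> to be small, since it lies at depth
  \<open>side R / 6\<close> in \<open>R\<close>; the upper Whitney bound forces \<open>R\<close> to
  be large, in proportion to the distance of \<open>x\<close> from the frontier.\<close>

lemma open_G: "open G"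
  unfolding open_contains_ball
proof
  fix x assume x: "x \<in> G"
  then obtain Q where Q: "Q \<in> \<W>" "x \<in> Q" using cover unfolding G_def by blast
  have "x \<in> \<Omega>" using x by (simp add: G_def)
  then obtain e where e: "e > 0" "ball x e \<subseteq> \<Omega>" using open_\<Omega> open_contains_ball by blast
  have "open (- hole Q)" "x \<in> - hole Q"
    using compact_hole x Q unfolding G_def by (auto intro: compact_imp_closed)
  then obtain e' where e': "e' > 0" "ball x e' \<subseteq> - hole Q" by (meson open_contains_ball)
  \<comment> \<open>With \<open>e/120\<close> the first bound reads \<open>side R < e/20\<close>.
    The Whitney bound gives \<open>e - e/120 \<le> 5 * diameter R \<le> 10 * side R < e/2\<close>, a
    contradiction.\<close>
  have "y \<in> G" if y: "y \<in> ball x (min e' (e/120))" for y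
  proof (rule ccontr)
    assume "y \<notin> G"
    moreover have "y \<in> \<Omega>" using y e by auto
    ultimately obtain R where R: "R \<in> \<W>" "y \<in> hole R" unfolding G_def by blast
    have dR: "dyadic_cube R" using dyadic R by blast
    have "R \<noteq> Q" using y e' R by auto
    then have "x \<notin> interior R" using not_in_other_interior Q R by blast
    then obtain i where "x$i \<le> corner R $ i \<or> corner R $ i + side R \<le> x$i"
      by (auto simp: mem_dyadic_cube[OF dR] not_less)
    then have "side R / 6 \<le> \<bar>x$i - y$i\<bar>"
      using hole_bounds[OF dR R(2), of i] side_pos[OF dR] by linarith
    then have "side R / 6 < e/120" using dist_vec2_ge[of x i y] y by simp
    have "y \<in> R" using R hole_subset_interior[OF dR] interior_subset by blast
    have "e - e/120 - diameter R \<le> setdist R (frontier \<Omega>)"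
    proof (rule le_setdistI)
      show "R \<noteq> {}" using \<open>y \<in> R\<close> by blast
      show "frontier \<Omega> \<noteq> {}" by (rule frontier_nonempty)
      fix q f assume qf: "q \<in> R" "f \<in> frontier \<Omega>"
      then have "f \<notin> ball x e" using e open_\<Omega> by (auto simp: frontier_def interior_open)
      moreover have "dist y q \<le> diameter R"
        using diameter_bounded_bound compact_imp_bounded[OF compact_dyadic_cube[OF dR]] \<open>y \<in> R\<close> qf by blast
      moreover have "dist x f \<le> dist x y + dist y q + dist q f" 
        by (meson dist_triangle dist_triangle_le add_le_cancel_right order_trans)
      ultimately show "e - e/120 - diameter R \<le> dist q f" using y by simp
    qed
    also have "\<dots> \<le> 4 * diameter R" by (rule whitney_dist[OF R(1)])
    finally have "e - e/120 \<le> 10 * side R" using diameter_dyadic_cube[OF dR] by simp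
    then show False using \<open>side R / 6 < e/120\<close> e by simp
  qed
  moreover have "min e' (e/120) > 0" using e e' by simp
  ultimately show "\<exists>e>0. ball x e \<subseteq> G" by blast
qed

text \<open>A separation of \<open>G\<close> puts each punctured cube on one side, so filling in the holes turns it
  into a separation of \<open>\<Omega>\<close>.\<close>

lemma connected_G: "connected G"
proof (rule connectedI)
  fix A B assume AB: "open A" "open B" "A \<inter> G \<noteq> {}" "B \<inter> G \<noteq> {}" "A \<inter> B \<inter> G = {}" "G \<subseteq> A \<union> B"
  have side: "Q - hole Q \<subseteq> A \<or> Q - hole Q \<subseteq> B" if "Q \<in> \<W>" for Q
    using connectedD[OF connected_cube_minus_hole[OF dyadic[OF that]] AB(1,2)]
      cube_minus_hole_subset[OF that] AB(5,6) by blast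
  \<comment> \<open>Points on common faces of cubes belong to no hole and are already covered by
    \<open>S \<inter> G\<close>, so adding the interiors suffices and keeps the set open.\<close>
  define fill where "fill S = S \<inter> G \<union> \<Union>{interior Q |Q. Q \<in> \<W> \<and> Q - hole Q \<subseteq> S}" for S
  have fill_open: "open (fill S)" if "open S" for S
    unfolding fill_def using that open_G by (intro open_Un open_Union) auto
  have nonempty: "Q - hole Q \<noteq> {}" if "Q \<in> \<W>" for Q
    using corner_mem[OF dyadic[OF that]] hole_bounds[OF dyadic[OF that], of "corner Q" 1] 
      side_pos[OF dyadic[OF that]] by auto
  have sub: "\<Omega> \<subseteq> fill A \<union> fill B"
  proof
    fix x assume x: "x \<in> \<Omega>"
    show "x \<in> fill A \<union> fill B"
    proof (cases "x \<in> G")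
      case False
      then obtain Q where "Q \<in> \<W>" "x \<in> hole Q" using x unfolding G_def by blast
      then show ?thesis using side[of Q] hole_subset_interior[OF dyadic] unfolding fill_def by blast
    qed (use AB(6) in \<open>auto simp: fill_def\<close>)
  qed
  have 1: "x \<in> S \<inter> G \<and> x \<in> T" if "x \<in> S \<inter> G" "x \<in> interior Q" "Q \<in> \<W>" "Q - hole Q \<subseteq> T" for x Q S T
    using that interior_subset[of Q] unfolding G_def by blast
  have "fill A \<inter> fill B = {}"
  proof (rule ccontr)
    assume "fill A \<inter> fill B \<noteq> {}"
    then obtain x where "x \<in> fill A" "x \<in> fill B" by blast
    then consider "x \<in> A \<inter> B \<inter> G" 
      | Q where "Q \<in> \<W>" "Q - hole Q \<subseteq> A" "x \<in> interior Q" "x \<in> B \<inter> G"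
      | Q where "Q \<in> \<W>" "Q - hole Q \<subseteq> B" "x \<in> interior Q" "x \<in> A \<inter> G"
      | Q R where "Q \<in> \<W>" "Q - hole Q \<subseteq> A" "x \<in> interior Q" "R \<in> \<W>" "R - hole R \<subseteq> B" "x \<in> interior R"
      unfolding fill_def by blast
    then show False
    proof cases
      case (4 Q R)
      then have "Q = R" using interiors_disjoint by blast
      then show False using 4 nonempty[of Q] cube_minus_hole_subset[of Q] AB(5) by blast
    qed (use 1 AB(5) in blast)+
  qed
  moreover have "fill A \<inter> \<Omega> \<noteq> {}" "fill B \<inter> \<Omega> \<noteq> {}"
    using AB(3,4) unfolding fill_def G_def by blast+
  ultimately show False
    using connectedD[OF connected_\<Omega> fill_open[OF AB(1)] fill_open[OF AB(2)]] sub by blast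
qed

lemma bounded_G: "bounded G"
  using bounded_\<Omega> unfolding G_def by (rule bounded_subset) blast

lemma whitney_nonempty: "\<exists>Q. Q \<in> \<W>"
  using cover nonempty_\<Omega> by blast

text \<open>Inside the left third of a cube, the hole is a single vertical segment.\<close>

lemma removed_segment:
  obtains c :: "real^2" and \<delta> where "\<delta> > 0"
    "\<And>z. \<bar>z$1 - c$1\<bar> < \<delta> \<Longrightarrow> \<bar>z$2 - c$2\<bar> < \<delta> \<Longrightarrow> z \<in> G \<longleftrightarrow> z$1 \<noteq> c$1"
proof -
  obtain Q where Q: "Q \<in> \<W>" using whitney_nonempty by blast
  define r d where "r = side Q" and "d = corner Q"
  have r: "r > 0" using side_pos[OF dyadic[OF Q]] by (simp add: r_def)
  \<comment> \<open>The middle of the isolated segment. Within \<open>r/6\<close> of it, abscissae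
    stay in the left third of the cube and heights in the middle third, so only the column
    \<open>1/6\<close> can meet the neighbourhood.\<close>
  define c :: "real^2" where "c = vector [d$1 + r/6, d$2 + r/2]"
  have "z \<in> G \<longleftrightarrow> z$1 \<noteq> c$1" if z: "\<bar>z$1 - c$1\<bar> < r/6" "\<bar>z$2 - c$2\<bar> < r/6" for z
  proof -
    have bnds: "d$1 < z$1" "z$1 < d$1 + r/3" "d$2 + r/3 < z$2" "z$2 < d$2 + 2*r/3"
      using z[unfolded abs_less_iff] by (auto simp: c_def)
    have int: "z \<in> interior Q"
      using bnds r by (auto simp: mem_dyadic_cube[OF dyadic[OF Q]] forall_2 r_def[symmetric] d_def[symmetric])
    then have "z \<in> \<Omega>" using cover Q interior_subset by blast
    have only: "z \<in> G \<longleftrightarrow> z \<notin> hole Q"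
      using \<open>z \<in> \<Omega>\<close> Q int not_in_other_interior[OF Q] cube_minus_hole_subset[OF Q] interior_subset[of Q]
      unfolding G_def by blast
    define w where "w = (1/r) *\<^sub>R (z - d)"
    have zw: "z = affine_map d r w" using r by (simp add: w_def)
    have "z \<in> hole Q \<longleftrightarrow> w \<in> unit_hole"
      using r unfolding hole_def r_def[symmetric] d_def[symmetric] zw by auto
    also have "\<dots> \<longleftrightarrow> w$1 = 1/6"
    proof -
      have "w$1 < 1/3" "1/3 < w$2" "w$2 < 2/3"
        using bnds r by (auto simp: w_def field_simps)
      then show ?thesis
        using hole_columns_subset unfolding unit_hole_def hole_columns_def by fastforce
    qed
    also have "\<dots> \<longleftrightarrow> z$1 = c$1" using r by (auto simp: w_def c_def field_simps)
    finally show ?thesis using only by blast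
  qed
  then show ?thesis using that[of "r/6" c] r by simp
qed

lemma nonempty_G: "G \<noteq> {}"
proof -
  obtain c :: "real^2" and \<delta> where c: "\<delta> > 0"
    "\<And>z. \<bar>z$1 - c$1\<bar> < \<delta> \<Longrightarrow> \<bar>z$2 - c$2\<bar> < \<delta> \<Longrightarrow> z \<in> G \<longleftrightarrow> z$1 \<noteq> c$1"
    by (rule removed_segment) blast
  from c(2)[of "vector [c$1 + \<delta>/2, c$2]"] show ?thesis using c(1) by auto
qed

lemma countable_\<W>: "countable \<W>"
proof -
  have ne: "interior Q \<noteq> {}" if "Q \<in> \<W>" for Q
    using interior_dyadic_cube[OF dyadic[OF that]] by (simp add: interval_ne_empty_cart)
  have "countable (interior ` \<W>)"
    using interiors_disjoint by (intro countable_disjoint_open_subsets) (auto simp: disjnt_def pairwise_def)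
  moreover have "inj_on interior \<W>"
    using interiors_disjoint ne by (intro inj_onI) (metis inf.idem)
  ultimately show ?thesis by (rule countable_image_inj_on)
qed

lemma AE_holes: "AE x in lborel. x \<in> \<Omega> \<longrightarrow> x \<in> G"
proof -
  have "hole Q \<in> null_sets lborel" if "Q \<in> \<W>" for Q
    unfolding hole_def using unit_hole_null side_pos[OF dyadic[OF that]]
    by (auto simp: null_sets_def emeasure_affine_image intro!: affine_image_measurable)
  then have "\<Union>(hole ` \<W>) \<in> null_sets lborel"
    using countable_\<W> by (intro null_sets_UN') auto
  then show ?thesis by (rule AE_I'[THEN eventually_mono]) (auto simp: G_def)
qed

lemma AE_interior: "AE x in lborel. x \<in> \<Omega> \<longrightarrow> (\<exists>Q\<in>\<W>. x \<in> interior Q)"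
proof -
  have "AE x in lborel. x \<in> Q \<longrightarrow> x \<in> interior Q" if "Q \<in> \<W>" for Q
  proof -
    have "convex Q" using dyadic[OF that] unfolding dyadic_cube_def by auto
    then have "negligible (frontier Q)" by (rule negligible_convex_frontier)
    then have "frontier Q \<in> null_sets lborel"
      by (auto simp: negligible_iff_null_sets null_sets_completion_iff)
    then show ?thesis
      by (rule AE_I'[THEN eventually_mono])
        (use compact_imp_closed[OF compact_dyadic_cube[OF dyadic[OF that]]] in \<open>auto simp: frontier_def\<close>)
  qed
  then have "AE x in lborel. \<forall>Q\<in>\<W>. x \<in> Q \<longrightarrow> x \<in> interior Q"
    using countable_\<W> by (simp add: AE_ball_countable)
  then show ?thesis using cover by (auto elim!: eventually_mono)
qed

end

section \<open>Zero extension\<close>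

lemma cross_energy_commute:
  assumes [measurable]: "v \<in> borel_measurable borel" "A \<in> sets borel" "B \<in> sets borel"
  shows "cross_energy p A B v = cross_energy p B A v"
proof -
  have "cross_energy p A B v = (\<integral>\<^sup>+x. (\<integral>\<^sup>+y. gag_kernel p v x y * indicator B y * indicator A x \<partial>lborel) \<partial>lborel)"
    unfolding cross_energy_def by (simp add: nn_integral_multc)
  also have "\<dots> = (\<integral>\<^sup>+y. (\<integral>\<^sup>+x. gag_kernel p v x y * indicator B y * indicator A x \<partial>lborel) \<partial>lborel)"
    by (rule lborel_pair.Fubini'[symmetric]) simp
  also have "\<dots> = (\<integral>\<^sup>+y. (\<integral>\<^sup>+x. gag_kernel p v y x * indicator A x * indicator B y \<partial>lborel) \<partial>lborel)"
    by (intro nn_integral_cong) (simp add: gag_kernel_commute ac_simps)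
  also have "\<dots> = cross_energy p B A v"
    unfolding cross_energy_def by (simp add: nn_integral_multc)
  finally show ?thesis .
qed

text \<open>Pairs with both points outside \<open>A\<close> contribute nothing and the two mixed
  terms agree by symmetry, so the cost of extension by zero is one cross energy.\<close>

lemma energy_UNIV_le:
  assumes [measurable]: "v \<in> borel_measurable borel" "A \<in> sets borel" 
    and "p > 0" and zero: "\<And>x. x \<notin> A \<Longrightarrow> v x = 0"
  shows "energy p UNIV v \<le> energy p A v + 2 * cross_energy p A (- A) v"
proof -
  have "gag_kernel p v x y = gag_kernel p v x y * indicator A y * indicator A x
      + gag_kernel p v x y * indicator (- A) y * indicator A x
      + gag_kernel p v x y * indicator A y * indicator (- A) x" for x y
    using zero[of x] zero[of y] \<open>p > 0\<close> by (auto simp: indicator_def gag_kernel_def)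
  then have "energy p UNIV v = (\<integral>\<^sup>+x. (\<integral>\<^sup>+y. gag_kernel p v x y * indicator A y * indicator A x
      + gag_kernel p v x y * indicator (- A) y * indicator A x
      + gag_kernel p v x y * indicator A y * indicator (- A) x \<partial>lborel) \<partial>lborel)"
    unfolding cross_energy_def by simp
  also have "\<dots> = energy p A v + cross_energy p A (- A) v + cross_energy p (- A) A v"
    unfolding cross_energy_def by (simp add: nn_integral_add nn_integral_multc)
  also have "cross_energy p (- A) A v = cross_energy p A (- A) v"
    by (rule cross_energy_commute) auto
  finally show ?thesis by (simp add: mult_2 add.assoc)
qed

lemma gagliardo_seminorm_energy:
  assumes "s * p = 1"
  shows "gagliardo_seminorm s p G (u :: real^2 \<Rightarrow> real) = ennpowr (energy p G u) (1 / p)"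
  using assms by (simp add: gagliardo_seminorm_def cross_energy_def gag_kernel_def)

lemma ennpowr_le_mult:
  assumes "x \<le> ennreal c * y" "c > 0" "a > 0"
  shows "ennpowr x a \<le> ennreal (c powr a) * ennpowr y a"
proof (cases "y = \<infinity>")
  case True
  then show ?thesis using assms by (simp add: ennpowr_def ennreal_mult_top)
next
  case False
  then obtain b where b: "y = ennreal b" "b \<ge> 0" by (cases y) auto
  then have "x \<le> ennreal (c * b)" using assms by (simp add: ennreal_mult')
  then obtain d where d: "x = ennreal d" "d \<ge> 0" by (cases x) (auto simp: top_unique)
  have "d \<le> c * b" using \<open>x \<le> ennreal (c * b)\<close> d b assms by (simp add: ennreal_le_iff)
  then have "d powr a \<le> c powr a * b powr a"
    using d b assms by (simp add: powr_mono2 flip: powr_mult)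
  then show ?thesis using b d by (simp add: ennpowr_def ennreal_leI flip: ennreal_mult')
qed

definition Cc_support :: "(real^2) set \<Rightarrow> (real^2 \<Rightarrow> real) \<Rightarrow> (real^2) set" where
  "Cc_support G u = G \<inter> closure (support_on G u)"

lemma
  assumes "u \<in> Cc G" "open G"
  shows compact_Cc_support: "compact (Cc_support G u)"
    and Cc_support_subset: "Cc_support G u \<subseteq> G"
    and zero_extension_support: "\<And>z. zero_extension G u z \<noteq> 0 \<Longrightarrow> z \<in> Cc_support G u"
    and zero_extension_measurable: "zero_extension G u \<in> borel_measurable borel"
proof -
  show "compact (Cc_support G u)" "Cc_support G u \<subseteq> G"
    using assms by (auto simp: Cc_def Cc_support_def)
  show "z \<in> Cc_support G u" if "zero_extension G u z \<noteq> 0" for z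
    using that closure_subset[of "support_on G u"]
    by (auto simp: zero_extension_def Cc_support_def support_on_def split: if_splits)
  have "(\<lambda>x. indicator G x *\<^sub>R u x) \<in> borel_measurable borel"
    using assms by (intro borel_measurable_continuous_on_indicator) (auto simp: Cc_def)
  moreover have "(\<lambda>x. indicator G x *\<^sub>R u x) = zero_extension G u"
    by (auto simp: zero_extension_def indicator_def)
  ultimately show "zero_extension G u \<in> borel_measurable borel" by simp
qed

text \<open>Supplies the finiteness that \<open>square_integral_le_energy\<close> asks for: the
  extension is bounded and lives on a compact set.\<close>

lemma power_integral_zero_extension_finite:
  assumes "u \<in> Cc G" "open G" "p > 0"
  shows "power_integral p UNIV (zero_extension G u) < \<infinity>"
proof -
  let ?M = "Cc_support G u"
  have M: "compact ?M" "?M \<subseteq> G" using compact_Cc_support Cc_support_subset assms by auto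
  have "compact (u ` ?M)"
    using M assms by (intro compact_continuous_image) (auto simp: Cc_def intro: continuous_on_subset)
  then obtain B where B: "B > 0" "\<And>x. x \<in> ?M \<Longrightarrow> \<bar>u x\<bar> \<le> B"
    using compact_imp_bounded bounded_pos by (metis image_eqI real_norm_def)
  have "ennreal (\<bar>zero_extension G u x\<bar> powr p) \<le> ennreal (B powr p) * indicator ?M x" for x
  proof (cases "zero_extension G u x = 0")
    case False
    then have "x \<in> ?M" using zero_extension_support assms by blast
    then show ?thesis using B assms M
      by (auto simp: zero_extension_def intro!: ennreal_leI powr_mono2)
  qed (use \<open>p > 0\<close> in simp)
  then have "power_integral p UNIV (zero_extension G u) \<le> (\<integral>\<^sup>+x. ennreal (B powr p) * indicator ?M x \<partial>lborel)"
    by (auto intro!: nn_integral_mono)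
  also have "\<dots> = ennreal (B powr p) * emeasure lborel ?M"
    using M by (intro nn_integral_cmult_indicator) (auto intro: borel_compact)
  also have "\<dots> < \<infinity>"
    using emeasure_bounded_finite[OF compact_imp_bounded[OF M(1)]] by (simp add: ennreal_mult_less_top)
  finally show ?thesis .
qed

context holed_domain
begin

text \<open>Only the cross energy of \<open>G\<close> with its complement needs control. Up to a
  null set this complement is the outside of \<open>\<Omega>\<close>, at distance at least
  \<open>side Q\<close> from each cube \<open>Q\<close>, so the inner integral is at most a multiple
  of \<open>\<bar>v x\<bar> powr p / side Q\<close>. The factor \<open>side Q\<close> in the
  Poincare inequality cancels the denominator, and disjointness of the interiors lets the cube
  energies be summed.\<close>

lemma energy_zero_extension_le:
  assumes "p > 1"
  obtains K where "K > 0" "\<And>u. u \<in> Cc G \<Longrightarrow> energy p UNIV (zero_extension G u) \<le> ennreal K * energy p G u"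
proof -
  have "p > 0" using assms by simp
  obtain A where A: "A > 0" and poincare:
    "\<And>v M d r. v \<in> borel_measurable borel \<Longrightarrow> compact M \<Longrightarrow> (\<And>z. v z \<noteq> 0 \<Longrightarrow> z \<in> M) \<Longrightarrow> r > 0
      \<Longrightarrow> M \<inter> affine_map d r ` unit_hole = {}
      \<Longrightarrow> power_integral p (affine_map d r ` box 0 1) v
        \<le> ennreal (A * r) * energy p (affine_map d r ` box 0 1) v"
    using hole_poincare[OF \<open>p > 0\<close>] by blast
  obtain C where C: "C > 0" and kernel: "\<And>L (x::real^2). L > 0 \<Longrightarrow>
    (\<integral>\<^sup>+y. ennreal (min 1 (L * dist x y) powr p / dist x y powr 3) \<partial>lborel) \<le> ennreal (C * L)"
    using kernel_integral_bound[OF assms] by blast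
  show ?thesis
  proof
    show "1 + 2 * (C * A) > 0" using A C by (simp add: add_pos_pos)
    fix u assume u: "u \<in> Cc G"
    define v where "v = zero_extension G u"
    define M where "M = Cc_support G u"
    have M: "compact M" "M \<subseteq> G" "\<And>z. v z \<noteq> 0 \<Longrightarrow> z \<in> M"
      unfolding M_def v_def using compact_Cc_support Cc_support_subset zero_extension_support u open_G by blast+
    have [measurable]: "v \<in> borel_measurable borel"
      unfolding v_def using zero_extension_measurable u open_G by blast
    have [measurable]: "G \<in> sets borel" using open_G by simp
    define F where "F x = (\<integral>\<^sup>+y\<in>- G. gag_kernel p v x y \<partial>lborel)" for x
    have [measurable]: "F \<in> borel_measurable borel" unfolding F_def by measurable
    have F_le: "F x \<le> ennreal (C / side Q) * ennreal (\<bar>v x\<bar> powr p)" if "Q \<in> \<W>" "x \<in> Q" for Q x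
    proof -
      have r: "side Q > 0" using side_pos dyadic that by blast
      \<comment> \<open>For almost every \<open>y\<close> outside \<open>G\<close> the minimum
        equals 1, so the truncated kernel with \<open>L = 1 / side Q\<close> coincides there with
        the power of the distance.\<close>
      have "AE y in lborel. gag_kernel p v x y * indicator (- G) y
          \<le> ennreal (\<bar>v x\<bar> powr p) * ennreal (min 1 (1 / side Q * dist x y) powr p / dist x y powr 3)"
        using AE_holes
      proof (rule eventually_mono)
        fix y assume y: "y \<in> \<Omega> \<longrightarrow> y \<in> G"
        show "gag_kernel p v x y * indicator (- G) y
          \<le> ennreal (\<bar>v x\<bar> powr p) * ennreal (min 1 (1 / side Q * dist x y) powr p / dist x y powr 3)"
        proof (cases "y \<in> G")
          case False
          then have "side Q \<le> dist x y" using side_le_dist that y by blast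
          then have "min 1 (1 / side Q * dist x y) = 1" using r by simp
          moreover have "v y = 0" using False by (simp add: v_def zero_extension_def)
          ultimately show ?thesis using False by (simp add: gag_kernel_def flip: ennreal_mult')
        qed simp
      qed
      then have "F x \<le> (\<integral>\<^sup>+y. ennreal (\<bar>v x\<bar> powr p) * ennreal (min 1 (1 / side Q * dist x y) powr p / dist x y powr 3) \<partial>lborel)"
        unfolding F_def by (rule nn_integral_mono_AE)
      also have "\<dots> = ennreal (\<bar>v x\<bar> powr p) * (\<integral>\<^sup>+y. ennreal (min 1 (1 / side Q * dist x y) powr p / dist x y powr 3) \<partial>lborel)"
        by (rule nn_integral_cmult) simp
      also have "\<dots> \<le> ennreal (\<bar>v x\<bar> powr p) * ennreal (C * (1 / side Q))"
        using r by (intro mult_left_mono kernel) auto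
      finally show ?thesis by (simp add: mult.commute)
    qed
    have cube: "(\<integral>\<^sup>+x\<in>interior Q. F x \<partial>lborel) \<le> ennreal (C * A) * energy p (interior Q) v" if Q: "Q \<in> \<W>" for Q
    proof -
      have r: "side Q > 0" using side_pos dyadic Q by blast
      have "(\<integral>\<^sup>+x\<in>interior Q. F x \<partial>lborel) \<le> (\<integral>\<^sup>+x. ennreal (C / side Q) * (ennreal (\<bar>v x\<bar> powr p) * indicator (interior Q) x) \<partial>lborel)"
        using F_le[OF Q] interior_subset[of Q] by (intro nn_integral_mono) (auto simp: indicator_def)
      also have "\<dots> = ennreal (C / side Q) * power_integral p (interior Q) v"
        by (rule nn_integral_cmult) simp
      also have "power_integral p (interior Q) v \<le> ennreal (A * side Q) * energy p (interior Q) v"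
        unfolding interior_dyadic_cube[OF dyadic[OF Q]]
      proof (rule poincare[OF _ M(1,3) r])
        show "M \<inter> affine_map (corner Q) (side Q) ` unit_hole = {}"
          using M(2) Q unfolding G_def hole_def[symmetric] by blast
      qed auto
      also have "ennreal (C / side Q) * (ennreal (A * side Q) * energy p (interior Q) v)
          = ennreal (C * A) * energy p (interior Q) v"
        using r A C by (simp add: mult.assoc[symmetric] flip: ennreal_mult)
      finally show ?thesis by (auto simp: mult_left_mono)
    qed
    have "cross_energy p G (- G) v = (\<integral>\<^sup>+x\<in>G. F x \<partial>lborel)"
      unfolding cross_energy_def F_def ..
    also have "\<dots> \<le> (\<integral>\<^sup>+x. (\<integral>\<^sup>+Q. F x * indicator (interior Q) x \<partial>count_space \<W>) \<partial>lborel)"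
    proof (rule nn_integral_mono_AE)
      show "AE x in lborel. F x * indicator G x \<le> (\<integral>\<^sup>+Q. F x * indicator (interior Q) x \<partial>count_space \<W>)"
        using AE_interior
      proof (rule eventually_mono)
        fix x assume x: "x \<in> \<Omega> \<longrightarrow> (\<exists>Q\<in>\<W>. x \<in> interior Q)"
        show "F x * indicator G x \<le> (\<integral>\<^sup>+Q. F x * indicator (interior Q) x \<partial>count_space \<W>)"
        proof (cases "x \<in> G")
          case True
          then obtain R where R: "R \<in> \<W>" "x \<in> interior R" using x by (auto simp: G_def)
          have "F x = (\<integral>\<^sup>+Q. F x * indicator {R} Q \<partial>count_space \<W>)"
            using R by (subst nn_integral_cmult_indicator) auto
          also have "\<dots> \<le> (\<integral>\<^sup>+Q. F x * indicator (interior Q) x \<partial>count_space \<W>)"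
            using R by (intro nn_integral_mono) (auto simp: indicator_def)
          finally show ?thesis using True by simp
        qed simp
      qed
    qed
    also have "\<dots> = (\<integral>\<^sup>+Q. (\<integral>\<^sup>+x. F x * indicator (interior Q) x \<partial>lborel) \<partial>count_space \<W>)"
      by (rule nn_integral_count_space_nn_integral[OF countable_\<W>]) auto
    also have "\<dots> \<le> (\<integral>\<^sup>+Q. ennreal (C * A) * energy p (interior Q) v \<partial>count_space \<W>)"
      using cube by (intro nn_integral_mono) auto
    also have "\<dots> = ennreal (C * A) * (\<integral>\<^sup>+Q. energy p (interior Q) v \<partial>count_space \<W>)"
      by (rule nn_integral_cmult) simp
    also have "\<dots> \<le> ennreal (C * A) * energy p \<Omega> v"
    proof (intro mult_left_mono disjoint_energy_le countable_\<W>)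
      show "disjoint_family_on interior \<W>"
        using interiors_disjoint by (auto simp: disjoint_family_on_def)
      show "interior Q \<subseteq> \<Omega>" if "Q \<in> \<W>" for Q using that interior_subset cover by blast
    qed auto
    also have "\<dots> \<le> ennreal (C * A) * energy p G v"
      using AE_holes by (intro mult_left_mono cross_energy_mono_AE) auto
    finally have cross: "cross_energy p G (- G) v \<le> ennreal (C * A) * energy p G v" .
    have "energy p UNIV v \<le> energy p G v + 2 * cross_energy p G (- G) v"
    proof (rule energy_UNIV_le)
      show "v x = 0" if "x \<notin> G" for x using that by (simp add: v_def zero_extension_def)
    qed (use \<open>p > 0\<close> in auto)
    also have "\<dots> \<le> energy p G v + 2 * (ennreal (C * A) * energy p G v)"
      by (intro add_left_mono mult_left_mono cross) auto
    also have "\<dots> = ennreal (1 + 2 * (C * A)) * energy p G v"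
      using A C by (simp add: distrib_right ennreal_mult mult.assoc)
    also have "energy p G v = energy p G u"
      by (rule cross_energy_cong) (auto simp: v_def zero_extension_def)
    finally show "energy p UNIV (zero_extension G u) \<le> ennreal (1 + 2 * (C * A)) * energy p G u"
      unfolding v_def .
  qed
qed

lemma admits_zero_extension_G:
  assumes "p > 1" "s * p = 1"
  shows "admits_zero_extension s p G"
proof -
  obtain K where K: "K > 0"
    "\<And>u. u \<in> Cc G \<Longrightarrow> energy p UNIV (zero_extension G u) \<le> ennreal K * energy p G u"
    using energy_zero_extension_le[OF assms(1)] by blast
  have "\<forall>u\<in>Cc G. gagliardo_seminorm s p UNIV (zero_extension G u) 
      \<le> ennreal (K powr (1/p)) * gagliardo_seminorm s p G u"
    unfolding gagliardo_seminorm_energy[OF assms(2)]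
    using K assms(1) by (auto intro!: ennpowr_le_mult)
  then show ?thesis
    unfolding admits_zero_extension_def using K(1) by (intro exI[of _ "K powr (1/p)"]) auto
qed

text \<open>The estimate by doubled squares lives on the whole plane, and the zero extension brings
  it back to \<open>G\<close>: for a test function, the area \<open>(side Q)\<^sup>2\<close> is at
  most \<open>C * side Q\<close> times the energy of its extension, hence at most
  \<open>C * K * side Q\<close> times its energy in \<open>G\<close>.\<close>

lemma side_le_frac_cap:
  assumes "p > 1" "s * p = 1"
  obtains K where "K > 0"
    "\<And>Q. dyadic_cube Q \<Longrightarrow> Q \<subseteq> G \<Longrightarrow> ennreal (side Q) \<le> ennreal K * frac_cap s p Q G"
proof -
  have "p > 0" using assms by simp
  obtain C where C: "C > 0"
    "\<And>v d r. v \<in> borel_measurable borel \<Longrightarrow> power_integral p UNIV v < \<infinity> \<Longrightarrow> r > 0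
      \<Longrightarrow> power_integral p (affine_map d r ` box 0 1) v \<le> ennreal (C * r) * energy p UNIV v"
    using square_integral_le_energy[OF \<open>p > 0\<close>] by blast
  obtain K where K: "K > 0"
    "\<And>u. u \<in> Cc G \<Longrightarrow> energy p UNIV (zero_extension G u) \<le> ennreal K * energy p G u"
    using energy_zero_extension_le[OF assms(1)] by blast
  have "ennreal (side Q) \<le> ennreal (C * K) * frac_cap s p Q G" if Q: "dyadic_cube Q" "Q \<subseteq> G" for Q
  proof -
    have r: "side Q > 0" by (rule side_pos[OF Q(1)])
    have "ennreal (side Q / (C * K)) \<le> energy p G u" if u: "u \<in> Cc G" "\<forall>x\<in>Q. u x \<ge> 1" for u
    proof -
      let ?v = "zero_extension G u"
      have "ennreal ((side Q)\<^sup>2) = (\<integral>\<^sup>+x. indicator (interior Q) x \<partial>lborel)"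
        unfolding interior_dyadic_cube[OF Q(1)] using r
        by (subst nn_integral_indicator)
          (auto simp: emeasure_affine_image emeasure_unit_square intro!: affine_image_measurable)
      also have "\<dots> \<le> power_integral p (interior Q) ?v"
      proof (rule nn_integral_mono)
        fix x
        show "indicator (interior Q) x \<le> ennreal (\<bar>?v x\<bar> powr p) * indicator (interior Q) x"
        proof (cases "x \<in> interior Q")
          case True
          then have "?v x = u x" "u x \<ge> 1"
            using Q interior_subset u by (auto simp: zero_extension_def)
          then show ?thesis using True \<open>p > 0\<close> by (simp add: ge_one_powr_ge_zero)
        qed simp
      qed
      also have "\<dots> \<le> ennreal (C * side Q) * energy p UNIV ?v"
        unfolding interior_dyadic_cube[OF Q(1)]
        using power_integral_zero_extension_finite[OF u(1) open_G \<open>p > 0\<close>]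
          zero_extension_measurable[OF u(1) open_G] r by (intro C(2)) auto
      also have "\<dots> \<le> ennreal (C * side Q) * (ennreal K * energy p G u)"
        using K(2)[OF u(1)] by (intro mult_left_mono) auto
      finally have "ennreal (1 / (C * K * side Q)) * ennreal ((side Q)\<^sup>2) 
          \<le> ennreal (1 / (C * K * side Q)) * (ennreal (C * side Q) * (ennreal K * energy p G u))"
        by (rule mult_left_mono) simp
      then show ?thesis
        using C K r by (simp add: mult.assoc[symmetric] power2_eq_square flip: ennreal_mult)
    qed
    then have "ennreal (side Q / (C * K)) \<le> frac_cap s p Q G"
      unfolding frac_cap_def using energy_gagliardo[OF assms(2) \<open>p > 0\<close>]
      by (intro INF_greatest) auto
    then have "ennreal (C * K) * ennreal (side Q / (C * K)) \<le> ennreal (C * K) * frac_cap s p Q G"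
      by (rule mult_left_mono) simp
    then show ?thesis using C K r by (simp flip: ennreal_mult)
  qed
  then show ?thesis using that[of "C * K"] C K by simp
qed

end

section \<open>Failure of quasiadditivity\<close>

text \<open>Quasiadditivity speaks about finite families; this carries a uniform bound on their sums
  over to the full countable family.\<close>

lemma nn_integral_count_space_le:
  fixes f :: "'a \<Rightarrow> ennreal"
  assumes "countable A" and le: "\<And>F. finite F \<Longrightarrow> F \<subseteq> A \<Longrightarrow> sum f F \<le> T"
  shows "(\<integral>\<^sup>+x. f x \<partial>count_space A) \<le> T"
proof -
  let ?B = "to_nat_on A ` A" and ?g = "from_nat_into A"
  have bij: "bij_betw ?g ?B A"
    using assms(1) by (intro bij_betw_byWitness[where f' = "to_nat_on A"]) auto
  have "(\<integral>\<^sup>+x. f x \<partial>count_space A) = (\<integral>\<^sup>+i. f (?g i) \<partial>count_space ?B)"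
    by (rule nn_integral_bij_count_space[OF bij, symmetric])
  also have "\<dots> = (\<Sum>i. f (?g i) * indicator ?B i)"
    by (simp add: nn_integral_count_space_indicator nn_integral_count_space_nat)
  also have "\<dots> \<le> T"
  proof (rule suminf_le_const)
    fix n
    have "inj_on ?g (?B \<inter> {..<n})" using bij by (meson bij_betw_def inj_on_subset inf_le1)
    then have "(\<Sum>i<n. f (?g i) * indicator ?B i) = sum f (?g ` (?B \<inter> {..<n}))"
      by (subst sum.reindex) (auto simp: indicator_def if_distrib sum.If_cases Int_commute cong: if_cong)
    also have "\<dots> \<le> T"
      using bij by (intro le) (auto simp: bij_betw_def)
    finally show "(\<Sum>i<n. f (?g i) * indicator ?B i) \<le> T" .
  qed simp
  finally show ?thesis .
qed

text \<open>To the right of the line, the strip between distances \<open>\<delta> / 2^Suc k\<close>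
  and \<open>\<delta> / 2^k\<close> has area \<open>\<delta>\<^sup>2 / 2^k\<close> and integrand at
  least \<open>2^k / \<delta>\<close>. Each of these disjoint strips contributes at least
  \<open>\<delta>\<close>.\<close>

lemma inverse_distance_integral_infinite:
  fixes c :: "real^2"
  assumes "\<delta> > 0"
  shows "(\<integral>\<^sup>+z\<in>{z::real^2. 0 < \<bar>z$1 - c$1\<bar> \<and> \<bar>z$1 - c$1\<bar> < \<delta> \<and> \<bar>z$2 - c$2\<bar> < \<delta>}. ennreal (1 / \<bar>z$1 - c$1\<bar>) \<partial>lborel) = \<infinity>"
    (is "(\<integral>\<^sup>+z\<in>?Z. ?f z \<partial>lborel) = _")
proof -
  define \<Lambda> where "\<Lambda> k = box (vector [c$1 + \<delta> / 2^Suc k, c$2 - \<delta>] :: real^2) (vector [c$1 + \<delta> / 2^k, c$2 + \<delta>])" for k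
  have mem: "z \<in> \<Lambda> k \<longleftrightarrow> c$1 + \<delta> / 2^Suc k < z$1 \<and> z$1 < c$1 + \<delta> / 2^k \<and> c$2 - \<delta> < z$2 \<and> z$2 < c$2 + \<delta>" for z k
    unfolding \<Lambda>_def by (auto simp: mem_box_cart forall_2)
  have disj: "j = k" if "z \<in> \<Lambda> j" "z \<in> \<Lambda> k" for z j k
  proof -
    have "\<not> j < k" if "z \<in> \<Lambda> j" "z \<in> \<Lambda> k" for j k
    proof
      assume "j < k"
      then have "(2::real)^Suc j \<le> 2^k" by (intro power_increasing) auto
      then have "\<delta> / 2^k \<le> \<delta> / 2^Suc j" using assms by (intro divide_left_mono) auto
      then show False using that unfolding mem by linarith
    qed
    then show ?thesis using that by (meson linorder_neqE_nat)
  qed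
  have lower: "of_nat n * ennreal \<delta> \<le> (\<integral>\<^sup>+z\<in>?Z. ?f z \<partial>lborel)" for n
  proof -
    have "of_nat n * ennreal \<delta> = (\<Sum>k<n. ennreal (2^k / \<delta>) * emeasure lborel (\<Lambda> k))"
    proof -
      have "ennreal (2^k / \<delta>) * emeasure lborel (\<Lambda> k) = ennreal \<delta>" for k
      proof -
        have "\<delta> / 2^Suc k \<le> \<delta> / 2^k" using assms by (intro divide_left_mono) auto
        then have "emeasure lborel (\<Lambda> k) = ennreal ((\<delta> / 2^k - \<delta> / 2^Suc k) * (2 * \<delta>))"
          unfolding \<Lambda>_def using assms by (subst emeasure_rectangle) auto
        moreover have "2^k / \<delta> * ((\<delta> / 2^k - \<delta> / 2^Suc k) * (2 * \<delta>)) = \<delta>"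
          using assms by (simp add: field_simps)
        ultimately show ?thesis
          using assms by (simp only:) (subst ennreal_mult[symmetric], auto simp: field_simps)
      qed
      then show ?thesis by simp
    qed
    also have "\<dots> = (\<integral>\<^sup>+z. (\<Sum>k<n. ennreal (2^k / \<delta>) * indicator (\<Lambda> k) z) \<partial>lborel)"
      by (subst nn_integral_sum) (auto simp: \<Lambda>_def nn_integral_cmult_indicator)
    also have "\<dots> \<le> (\<integral>\<^sup>+z\<in>?Z. ?f z \<partial>lborel)"
    proof (rule nn_integral_mono)
      fix z
      show "(\<Sum>k<n. ennreal (2^k / \<delta>) * indicator (\<Lambda> k) z) \<le> ?f z * indicator ?Z z"
      proof (cases "\<exists>j<n. z \<in> \<Lambda> j")
        case True
        then obtain j where j: "j < n" "z \<in> \<Lambda> j" by blast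
        have "(\<Sum>k<n. ennreal (2^k / \<delta>) * indicator (\<Lambda> k) z) = (\<Sum>k<n. if k = j then ennreal (2^j / \<delta>) else 0)"
          using j disj by (intro sum.cong) (auto simp: indicator_def)
        also have "\<dots> = ennreal (2^j / \<delta>)" using j by simp
        also have "\<dots> \<le> ?f z * indicator ?Z z"
        proof -
          have "0 < \<delta> / 2^Suc j" "\<delta> / 2^j \<le> \<delta>"
            using assms by (auto simp: field_simps)
          then have "z \<in> ?Z" "0 < z$1 - c$1" "z$1 - c$1 < \<delta> / 2^j" using j(2) unfolding mem by auto
          moreover from this have "2^j / \<delta> \<le> 1 / \<bar>z$1 - c$1\<bar>"
            using assms by (simp add: field_simps)
          ultimately show ?thesis by (simp add: ennreal_leI)
        qed
        finally show ?thesis .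
      next
        case False
        then have "(\<Sum>k<n. ennreal (2^k / \<delta>) * indicator (\<Lambda> k) z) = 0" by (intro sum.neutral) auto
        then show ?thesis by simp
      qed
    qed
    finally show ?thesis .
  qed
  have exceeds: "\<exists>n. T < of_nat n * ennreal \<delta>" if fin: "T < \<infinity>" for T
  proof -
    obtain t where t: "T = ennreal t" "t \<ge> 0" using fin by (cases T) auto
    obtain n :: nat where "t < real n * \<delta>" using reals_Archimedean3[OF assms] by blast
    then have "T < of_nat n * ennreal \<delta>"
      using t assms by (simp add: ennreal_of_nat_eq_real_of_nat ennreal_lessI flip: ennreal_mult)
    then show ?thesis ..
  qed
  show ?thesis
  proof (rule ccontr)
    assume "(\<integral>\<^sup>+z\<in>?Z. ?f z \<partial>lborel) \<noteq> \<infinity>"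
    then have "(\<integral>\<^sup>+z\<in>?Z. ?f z \<partial>lborel) < \<infinity>" unfolding infinity_ennreal_def by (rule top.not_eq_extremum[THEN iffD1])
    from exceeds[OF this] obtain n where "(\<integral>\<^sup>+z\<in>?Z. ?f z \<partial>lborel) < of_nat n * ennreal \<delta>" ..
    with leD[OF lower[of n]] show False by (rule notE)
  qed
qed

text \<open>The integral of the inverse distance from the line links area to side lengths. A Whitney
  cube near the segment has side at most its distance from it, so its share of the integral is at
  most \<open>(side Q)\<^sup>2 / side Q\<close>. Weak quasiadditivity would bound all finite sums of
  sides by \<open>K * N * A\<close>, and thereby a divergent integral.\<close>

lemma (in holed_domain) not_weakly_quasiadditive_G:
  assumes "p > 1" "s * p = 1" and whitney_G: "whitney_decomposition C' G \<V>"
  shows "\<not> weakly_quasiadditive s p G \<V>"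
proof
  assume "weakly_quasiadditive s p G \<V>"
  then obtain N where N: "N > 0" "\<And>\<E>. finite \<E> \<Longrightarrow> \<E> \<subseteq> \<V> \<Longrightarrow>
        (\<Sum>\<^sub>\<infinity>Q\<in>\<V>. frac_cap s p (\<Union>\<E> \<inter> Q) G) \<le> ennreal N * frac_cap s p (\<Union>\<E>) G"
    unfolding weakly_quasiadditive_def by blast
  have "p > 0" using assms by simp
  interpret V: holed_domain G \<V> C'
    using open_G connected_G bounded_G nonempty_G whitney_G by unfold_locales
  obtain c :: "real^2" and \<delta> where \<delta>: "\<delta> > 0" and
    seg: "\<And>z. \<bar>z$1 - c$1\<bar> < \<delta> \<Longrightarrow> \<bar>z$2 - c$2\<bar> < \<delta> \<Longrightarrow> z \<in> G \<longleftrightarrow> z$1 \<noteq> c$1"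
    by (rule removed_segment) blast
  obtain K where K: "K > 0"
    "\<And>Q. dyadic_cube Q \<Longrightarrow> Q \<subseteq> G \<Longrightarrow> ennreal (side Q) \<le> ennreal K * frac_cap s p Q G"
    using side_le_frac_cap[OF assms(1,2)] by blast
  obtain A where cutoff: "\<And>\<rho>. 0 < \<rho> \<Longrightarrow> \<rho> \<le> \<delta> \<Longrightarrow> \<exists>u. continuous_on UNIV u
    \<and> (\<forall>z. u z \<noteq> 0 \<longrightarrow> \<rho>/2 \<le> \<bar>z$1 - c$1\<bar> \<and> \<bar>z$1 - c$1\<bar> \<le> \<delta>/2 \<and> \<bar>z$2 - c$2\<bar> \<le> \<delta>/2)
    \<and> (\<forall>z. \<rho> \<le> \<bar>z$1 - c$1\<bar> \<and> \<bar>z$1 - c$1\<bar> \<le> \<delta>/4 \<and> \<bar>z$2 - c$2\<bar> \<le> \<delta>/4 \<longrightarrow> u z = 1)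
    \<and> energy p UNIV u \<le> ennreal A"
    using segment_cutoff[OF assms(1) \<delta>, of c] by blast
  \<comment> \<open>The point of the segment at the height of \<open>z\<close> lies on the frontier
    of \<open>G\<close>: it is missing from \<open>G\<close>, but points slightly to its right
    belong to \<open>G\<close>.\<close>
  have diam: "diameter Q \<le> \<bar>z$1 - c$1\<bar>" if "Q \<in> \<V>" "z \<in> Q" "\<bar>z$2 - c$2\<bar> < \<delta>" for Q z
  proof -
    define w :: "real^2" where "w = vector [c$1, z$2]"
    have "w \<notin> G" using seg[of w] that \<delta> by (simp add: w_def)
    moreover have "w \<in> closure G"
      unfolding closure_approachable
    proof (intro allI impI)
      fix e :: real assume e: "e > 0"
      define y :: "real^2" where "y = vector [c$1 + min e \<delta> / 2, z$2]"
      have "y \<in> G" using seg[of y] that \<delta> e by (auto simp: y_def)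
      moreover have "dist y w < e" using dist_vec2_le[of y w] e \<delta> by (auto simp: y_def w_def)
      ultimately show "\<exists>y\<in>G. dist y w < e" by blast
    qed
    ultimately have "w \<in> frontier G" using open_G by (simp add: frontier_def interior_open)
    then have "setdist Q (frontier G) \<le> dist z w" using that by (intro setdist_le_dist)
    also have "\<dots> \<le> \<bar>z$1 - c$1\<bar>" using dist_vec2_le[of z w] by (simp add: w_def)
    finally show ?thesis using V.whitney_dist[OF that(1)] by simp
  qed
  \<comment> \<open>With \<open>\<delta>/16\<close>, a cube that meets \<open>Z\<close> has diameter
    below \<open>\<delta>/16\<close> and stays within \<open>\<delta>/8\<close> of \<open>c\<close>
    in each coordinate, inside the range \<open>\<delta>/4\<close> where the cutoff can equal
    1.\<close>
  define Z where "Z = {z::real^2. 0 < \<bar>z$1 - c$1\<bar> \<and> \<bar>z$1 - c$1\<bar> < \<delta>/16 \<and> \<bar>z$2 - c$2\<bar> < \<delta>/16}"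
  define \<Q> where "\<Q> = {Q \<in> \<V>. Q \<inter> Z \<noteq> {}}"
  have near: "\<bar>z$1 - c$1\<bar> < \<delta>/8 \<and> \<bar>z$2 - c$2\<bar> < \<delta>/8 \<and> side Q \<le> \<bar>z$1 - c$1\<bar>" if "Q \<in> \<Q>" "z \<in> Q" for Q z
  proof -
    obtain w where w: "w \<in> Q" "w \<in> Z" using \<open>Q \<in> \<Q>\<close> unfolding \<Q>_def by blast
    have Q: "Q \<in> \<V>" using \<open>Q \<in> \<Q>\<close> unfolding \<Q>_def by blast
    have "dist z w \<le> diameter Q"
      using diameter_bounded_bound compact_imp_bounded[OF compact_dyadic_cube[OF V.dyadic[OF Q]]] that w by blast
    moreover have "diameter Q < \<delta>/16"
      using diam[OF Q w(1)] w(2) \<delta> unfolding Z_def by auto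
    ultimately have "\<bar>z$i - w$i\<bar> < \<delta>/16" for i using dist_vec2_ge[of z i w] by linarith
    note zw = this[of 1] this[of 2]
    moreover have "\<bar>w$1 - c$1\<bar> < \<delta>/16" "\<bar>w$2 - c$2\<bar> < \<delta>/16"
      using w(2) unfolding Z_def by blast+
    ultimately have *: "\<bar>z$1 - c$1\<bar> < \<delta>/8" "\<bar>z$2 - c$2\<bar> < \<delta>/8"
      using abs_triangle_ineq[of "z$1 - w$1" "w$1 - c$1"] abs_triangle_ineq[of "z$2 - w$2" "w$2 - c$2"] zw
      by simp_all
    moreover have "side Q \<le> \<bar>z$1 - c$1\<bar>"
      using diam[OF Q that(2)] diameter_dyadic_cube[OF V.dyadic[OF Q]] * \<delta> by simp
    ultimately show ?thesis by blast
  qed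
  have cap_le: "frac_cap s p (\<Union>\<E>) G \<le> ennreal A" if \<E>: "finite \<E>" "\<E> \<subseteq> \<Q>" for \<E>
  proof -
    \<comment> \<open>By \<open>near\<close>, points of a cube have horizontal distance at least
      \<open>side Q\<close> from the segment, so a cutoff at the smallest side equals 1 on the whole
      family. Inserting \<open>\<delta>\<close> ensures \<open>\<rho> \<le> \<delta>\<close> and
      covers the empty family.\<close>
    define \<rho> where "\<rho> = Min (insert \<delta> (side ` \<E>))"
    have \<rho>: "0 < \<rho>" "\<rho> \<le> \<delta>" "\<And>Q. Q \<in> \<E> \<Longrightarrow> \<rho> \<le> side Q"
      using \<E> \<delta> side_pos V.dyadic unfolding \<rho>_def \<Q>_def by auto
    obtain u where u: "continuous_on UNIV u" "energy p UNIV u \<le> ennreal A"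
      "\<And>z. u z \<noteq> 0 \<Longrightarrow> \<rho>/2 \<le> \<bar>z$1 - c$1\<bar> \<and> \<bar>z$1 - c$1\<bar> \<le> \<delta>/2 \<and> \<bar>z$2 - c$2\<bar> \<le> \<delta>/2"
      "\<And>z. \<rho> \<le> \<bar>z$1 - c$1\<bar> \<Longrightarrow> \<bar>z$1 - c$1\<bar> \<le> \<delta>/4 \<Longrightarrow> \<bar>z$2 - c$2\<bar> \<le> \<delta>/4 \<Longrightarrow> u z = 1"
      using cutoff[OF \<rho>(1,2)] by blast
    define S where "S = {z::real^2. \<rho>/2 \<le> \<bar>z$1 - c$1\<bar> \<and> \<bar>z$1 - c$1\<bar> \<le> \<delta>/2 \<and> \<bar>z$2 - c$2\<bar> \<le> \<delta>/2}"
    have "closed S" unfolding S_def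
      by (intro closed_Collect_conj closed_Collect_le continuous_intros)
    have "S \<subseteq> G"
    proof
      fix z assume "z \<in> S"
      then show "z \<in> G" using seg[of z] \<rho> \<delta> unfolding S_def by auto
    qed
    have "closure (support_on G u) \<subseteq> S"
      using u(3) \<open>closed S\<close> by (intro closure_minimal) (auto simp: support_on_def S_def)
    then have "G \<inter> closure (support_on G u) = closure (support_on G u)" using \<open>S \<subseteq> G\<close> by blast
    moreover have "bounded (closure (support_on G u))"
      using \<open>closure (support_on G u) \<subseteq> S\<close> \<open>S \<subseteq> G\<close> bounded_G by (meson bounded_subset)
    ultimately have "u \<in> Cc G"
      using u(1) by (auto simp: Cc_def compact_eq_bounded_closed intro: continuous_on_subset)
    moreover have "u z \<ge> 1" if z: "z \<in> \<Union>\<E>" for z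
    proof -
      obtain Q where Q: "Q \<in> \<E>" "z \<in> Q" using z by blast
      then have "Q \<in> \<Q>" using \<E> by blast
      then show ?thesis using near[of Q z] Q \<rho>(3)[OF Q(1)] u(4)[of z] \<delta> by simp
    qed
    ultimately have "frac_cap s p (\<Union>\<E>) G \<le> ennpowr (gagliardo_seminorm s p G u) p"
      unfolding frac_cap_def by (intro INF_lower) auto
    also have "\<dots> = energy p G u" by (rule energy_gagliardo[OF assms(2) \<open>p > 0\<close>])
    also have "\<dots> \<le> energy p UNIV u" by (rule cross_energy_mono) auto
    finally show ?thesis using u(2) by simp
  qed
  have sum_le: "(\<Sum>Q\<in>\<E>. ennreal (side Q)) \<le> ennreal K * (ennreal N * ennreal A)" if \<E>: "finite \<E>" "\<E> \<subseteq> \<Q>" for \<E>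
  proof -
    have "\<E> \<subseteq> \<V>" using \<E> unfolding \<Q>_def by blast
    have "(\<Sum>Q\<in>\<E>. ennreal (side Q)) \<le> (\<Sum>Q\<in>\<E>. ennreal K * frac_cap s p Q G)"
      using \<open>\<E> \<subseteq> \<V>\<close> V.dyadic V.cover by (intro sum_mono K(2)) blast+
    also have "\<dots> = ennreal K * (\<Sum>Q\<in>\<E>. frac_cap s p (\<Union>\<E> \<inter> Q) G)"
      unfolding sum_distrib_left[symmetric]
      by (intro arg_cong2[where f = "(*)"] sum.cong refl arg_cong2[where f = "frac_cap s p"]) auto
    \<comment> \<open>The sum over all of \<open>\<V>\<close> has further nonnegative terms, from
      cubes outside \<open>\<E>\<close> that meet \<open>\<Union>\<E>\<close> along faces.\<close>
    also have "\<dots> \<le> ennreal K * (\<Sum>\<^sub>\<infinity>Q\<in>\<V>. frac_cap s p (\<Union>\<E> \<inter> Q) G)"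
      using \<E> \<open>\<E> \<subseteq> \<V>\<close> by (subst nonneg_infsum_complete) (auto intro!: mult_left_mono SUP_upper)
    also have "\<dots> \<le> ennreal K * (ennreal N * frac_cap s p (\<Union>\<E>) G)"
      using N(2)[OF \<E>(1) \<open>\<E> \<subseteq> \<V>\<close>] by (intro mult_left_mono) auto
    also have "\<dots> \<le> ennreal K * (ennreal N * ennreal A)"
      by (intro mult_left_mono cap_le \<E>) auto
    finally show ?thesis .
  qed
  have countable: "countable \<Q>"
    using V.countable_\<W> by (rule countable_subset[rotated]) (auto simp: \<Q>_def)
  have "(\<integral>\<^sup>+z\<in>Z. ennreal (1 / \<bar>z$1 - c$1\<bar>) \<partial>lborel)
    \<le> (\<integral>\<^sup>+z. (\<integral>\<^sup>+Q. ennreal (1 / \<bar>z$1 - c$1\<bar>) * indicator Q z \<partial>count_space \<Q>) \<partial>lborel)"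
  proof (rule nn_integral_mono)
    fix z
    show "ennreal (1 / \<bar>z$1 - c$1\<bar>) * indicator Z z \<le> (\<integral>\<^sup>+Q. ennreal (1 / \<bar>z$1 - c$1\<bar>) * indicator Q z \<partial>count_space \<Q>)"
    proof (cases "z \<in> Z")
      case True
      then have "z \<in> G" using seg[of z] \<delta> unfolding Z_def by auto
      then obtain R where R: "R \<in> \<Q>" "z \<in> R" using True V.cover unfolding \<Q>_def by blast
      have "ennreal (1 / \<bar>z$1 - c$1\<bar>) = (\<integral>\<^sup>+Q. ennreal (1 / \<bar>z$1 - c$1\<bar>) * indicator {R} Q \<partial>count_space \<Q>)"
        using R by (subst nn_integral_cmult_indicator) auto
      also have "\<dots> \<le> (\<integral>\<^sup>+Q. ennreal (1 / \<bar>z$1 - c$1\<bar>) * indicator Q z \<partial>count_space \<Q>)"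
        using R by (intro nn_integral_mono) (auto simp: indicator_def)
      finally show ?thesis using True by simp
    qed simp
  qed
  also have "\<dots> = (\<integral>\<^sup>+Q. (\<integral>\<^sup>+z. ennreal (1 / \<bar>z$1 - c$1\<bar>) * indicator Q z \<partial>lborel) \<partial>count_space \<Q>)"
  proof (rule nn_integral_count_space_nn_integral[OF countable])
    fix Q assume "Q \<in> \<Q>"
    then have [measurable]: "Q \<in> sets borel"
      using compact_dyadic_cube V.dyadic unfolding \<Q>_def by (auto intro: borel_compact)
    show "(\<lambda>z. ennreal (1 / \<bar>z$1 - c$1\<bar>) * indicator Q z) \<in> borel_measurable lborel" by measurable
  qed
  also have "\<dots> \<le> (\<integral>\<^sup>+Q. ennreal (side Q) \<partial>count_space \<Q>)"
  proof (rule nn_integral_mono)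
    fix Q assume "Q \<in> space (count_space \<Q>)"
    then have Q: "Q \<in> \<Q>" "dyadic_cube Q" using V.dyadic by (auto simp: \<Q>_def)
    have r: "side Q > 0" by (rule side_pos[OF Q(2)])
    have [measurable]: "Q \<in> sets borel" using compact_dyadic_cube[OF Q(2)] by (rule borel_compact)
    have "(\<integral>\<^sup>+z. ennreal (1 / \<bar>z$1 - c$1\<bar>) * indicator Q z \<partial>lborel) \<le> (\<integral>\<^sup>+z. ennreal (1 / side Q) * indicator Q z \<partial>lborel)"
      using near[OF Q(1)] r by (intro nn_integral_mono) (auto simp: indicator_def intro!: ennreal_leI frac_le)
    also have "\<dots> = ennreal (1 / side Q) * emeasure lborel Q"
      by (rule nn_integral_cmult_indicator) simp
    also have "emeasure lborel Q = ennreal ((side Q)\<^sup>2)"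
      using r by (subst dyadic_cube_eq[OF Q(2)], subst emeasure_affine_image) (auto simp: emeasure_rectangle)
    also have "ennreal (1 / side Q) * \<dots> = ennreal (side Q)"
      using r by (simp add: power2_eq_square flip: ennreal_mult)
    finally show "(\<integral>\<^sup>+z. ennreal (1 / \<bar>z$1 - c$1\<bar>) * indicator Q z \<partial>lborel) \<le> ennreal (side Q)" .
  qed
  also have "\<dots> \<le> ennreal K * (ennreal N * ennreal A)"
    using countable sum_le by (rule nn_integral_count_space_le)
  also have "\<dots> < \<infinity>" by (simp add: ennreal_mult_less_top)
  finally show False
    using inverse_distance_integral_infinite[of "\<delta>/16" c] \<delta> unfolding Z_def by simp
qed

theorem theorem9:
  fixes s p :: real and \<W> :: "(real^2) set \<Rightarrow> (real^2) set set"
  assumes "whitney_choice \<W>"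
    and "0 < s" and "s < 1" and "1 < p" and "s * p = 1"
  shows "\<exists>G :: (real^2) set. open G \<and> connected G \<and> G \<noteq> {} \<and> bounded G \<and>
           admits_zero_extension s p G \<and> \<not> weakly_quasiadditive s p G (\<W> G)"
proof -
  obtain C where C: "\<And>G. open G \<Longrightarrow> G \<noteq> {} \<Longrightarrow> G \<noteq> UNIV \<Longrightarrow> whitney_decomposition C G (\<W> G)"
    using assms(1) unfolding whitney_choice_def by blast
  have proper: "S \<noteq> UNIV" if "bounded S" for S :: "(real^2) set"
    using that not_bounded_UNIV by blast
  \<comment> \<open>The given choice \<open>\<W>\<close> is used for the disc here and for
    \<open>G\<close> afterwards. As nothing relates the two decompositions, the failure was proved
    for an arbitrary Whitney decomposition of \<open>G\<close>.\<close>
  interpret holed_domain "ball 0 1" "\<W> (ball 0 1)" C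
    by unfold_locales (auto intro!: C proper)
  have "whitney_decomposition C G (\<W> G)"
    by (intro C open_G nonempty_G proper bounded_G)
  then have "\<not> weakly_quasiadditive s p G (\<W> G)"
    by (rule not_weakly_quasiadditive_G[OF assms(4,5)])
  then show ?thesis
    using open_G connected_G nonempty_G bounded_G admits_zero_extension_G[OF assms(4,5)] by blast
qed

end
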